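(* Let $g,r,d\ge 1$ be integers with $d\ge g$, $r+g-d\ge 0$ and $N:=\binom{r+2}{2}-2d+g\ge 1$, so that the dimension $\binom{r+2}{2}$ of the domain of the quadratic multiplication map $v_2:\operatorname{Sym}^2V\to H^0(C,L^{\otimes 2})$ of a $\mathfrak g^r_d$ on a general curve $C$ of genus $g$ is $N-1$ more than the dimension $2d-g+1$ of its target. Assume also that $D(g,r,d):=\rho(g,r,d)-N\ge 0$, where $\rho(g,r,d)=g-(r+1)(r+g-d)$. Then: \begin{enumerate} \item If $N\le 2$, the SMRC class is strictly positive, except when either (i) $N=1$ and $(g,r,d)\in\{(1,2,3),(5,3,7)\}$; or (ii) $N=2$ and $(g,r,d)\in\{(2,3,5),(7,4,10)\}$. \item If $3\le N\le 7$, the SMRC class is strictly positive. \item If $r\ge 12N-2$, the SMRC class is strictly positive. \end{enumerate}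
   Context: $C$ is a smooth irreducible projective curve of genus $g$ over an algebraically closed field, general in moduli (Brill--Noether and Petri general). $G^r_d(C)$ is the moduli scheme of linear series $\mathfrak g^r_d=(L,V)$ on $C$ ($\deg L=d$, $V\subset H^0(L)$, $\dim V=r+1$), $p':G^r_d(C)\to\operatorname{Pic}^d(C)$ is the forgetful map, $\mathscr V$ is the rank-$(r+1)$ universal subbundle on $G^r_d(C)$, and $\mathscr M$ is the pullback to $C\times G^r_d(C)$ of a Poincaré line bundle on $C\times \operatorname{Pic}^d(C)$. Let $\mathbf E=\operatorname{Sym}^2\mathscr V$ (rank $\binom{r+2}{2}$) and $\mathbf F=\pi'_{2*}(\mathscr M^{\otimes 2})$ (rank $2d-g+1$), with $\pi_2':C\times G^r_d(C)\to G^r_d(C)$ the projection. Multiplication of sections gives $\phi:\mathbf E\to\mathbf F$, and the (quadratic) SMRC locus $\mathcal M^r_d(C)\subset G^r_d(C)$ is the degeneracy locus where $\phi$ fails to have maximal rank, i.e. the locus of $(L,V)$ for which $v_2:\operatorname{Sym}^2V\to H^0(L^{\otimes 2})$ is not of maximal rank. Its class, of expected codimension $N$, is given by Porteous' formula, $c_N(\mathbf E^\vee-\mathbf F^\vee)$. The SMRC class is the pushforward of this class to $\operatorname{Pic}^d(C)$, up to numerical equivalence. It is called strictly positive if its intersection number with the complementary power $\theta^{\rho-N}$ of the theta class $\theta$ is $>0$. Explicitly, the SMRC class to which the theorem refers is $S(g,r,d)\,\theta^{N+g-\rho}$ with $$S(g,r,d)=(-1)^N\sum_{I}\frac{2^{2N-|I|}d_I}{(N-\deg(s_I))!}\cdot\frac{\prod_{1\le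 j<\ell\le r+1}(i_\ell-i_j)}{\prod_{j=1}^{r+1}(i_j+r+g-d)!},$$ where the sum is over all strictly increasing sequences $I=(i_1<\dots<i_{r+1})$ of non-negative integers with $|I|:=\sum_j i_j\le\binom{r+1}{2}+N$, $\deg(s_I):=|I|-\binom{r+1}{2}$, and $d_I=\det\big[(-1)^{i_a}\binom{2(r+1)-2b+1}{i_a}\big]_{1\le a,b\le r+1}$. Since $\theta^g$ has degree $g!>0$, strict positivity of the class is equivalent to $S(g,r,d)>0$. *)

theory Defs
  imports "Jordan_Normal_Form.Determinant" "HOL-Computational_Algebra.Polynomial"
begin

(* Linear series g^r_d = (L, V) on a general curve of genus g: rho is the Brill--Noether number,
   and N is the expected codimension of the locus in G^r_d(C) where Sym^2 V -> H^0(L^2) fails to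
   have maximal rank, when rank Sym^2 V exceeds h^0(L^2) = 2d - g + 1 by N - 1 >= 0.
   Both are integers, so no truncated subtraction takes place. *)

definition rho :: "nat \<Rightarrow> nat \<Rightarrow> nat \<Rightarrow> int" where
  "rho g r d = int g - (int r + 1) * (int r + int g - int d)"

definition smrc_codim :: "nat \<Rightarrow> nat \<Rightarrow> nat \<Rightarrow> int" where
  "smrc_codim g r d = int ((r + 2) choose 2) - 2 * int d + int g"

(* A sequence i_1 < ... < i_{r+1} is a list I of length r + 1 with i_a = I ! (a - 1). *)

definition smrc_index :: "nat \<Rightarrow> int \<Rightarrow> nat list set" where
  "smrc_index r N =
     {I. length I = r + 1 \<and> sorted_wrt (<) I \<and> int (sum_list I) \<le> int ((r + 1) choose 2) + N}"

lemma finite_smrc_index: "finite (smrc_index r N)"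
proof (rule finite_subset)
  let ?B = "{..nat (int ((r + 1) choose 2) + N)}"
  show "smrc_index r N \<subseteq> {I. set I \<subseteq> ?B \<and> length I = r + 1}"
  proof
    fix I assume I: "I \<in> smrc_index r N"
    have "x \<in> ?B" if "x \<in> set I" for x
      using member_le_sum_list[OF that] I unfolding smrc_index_def by simp linarith
    with I show "I \<in> {I. set I \<subseteq> ?B \<and> length I = r + 1}"
      by (auto simp: smrc_index_def)
  qed
  show "finite {I. set I \<subseteq> ?B \<and> length I = r + 1}"
    by (rule finite_lists_length_eq) simp
qed

definition schur_deg :: "nat list \<Rightarrow> int" where
  "schur_deg I = int (sum_list I) - int (length I choose 2)"

(* Matrix indices of mat run over 0..r; with b = Suc b' the upper argument of the binomial
   coefficient is 2(r+1) - 2b + 1 >= 1, so the natural-number subtraction is exact. *)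

definition sym2_det :: "nat \<Rightarrow> nat list \<Rightarrow> rat" where
  "sym2_det r I = det (mat (r + 1) (r + 1)
     (\<lambda>(a, b'). (- 1) ^ (I ! a) * of_nat ((2 * (r + 1) - 2 * Suc b' + 1) choose (I ! a))))"

(* The coefficient S(g,r,d). The exponent 2N - |I| can be negative, hence powi. For I in the index
   set N - deg(s_I) >= 0, so nat is exact there; r + g - d is exact for d <= r + g. *)

definition smrc_coeff :: "nat \<Rightarrow> nat \<Rightarrow> nat \<Rightarrow> rat" where
  "smrc_coeff g r d = (let N = smrc_codim g r d in
     (- 1) powi N *
     (\<Sum>I\<in>smrc_index r N.
        2 powi (2 * N - int (sum_list I)) * sym2_det r I / fact (nat (N - schur_deg I)) *
        ((\<Prod>l<r + 1. \<Prod>j<l. of_nat (I ! l) - of_nat (I ! j)) /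
         (\<Prod>j<r + 1. fact (I ! j + (r + g - d))))))"

(* Polynomials in theta represent numerical classes on Pic^d(C), which has dimension g;
   the intersection number picks out the theta^g-part, and theta^g has degree g!. *)

definition theta :: "rat poly" where
  "theta = monom 1 1"

definition pic_degree :: "nat \<Rightarrow> rat poly \<Rightarrow> rat" where
  "pic_degree g p = coeff p g * fact g"

(* The pushforward to Pic^d(C) has codimension N + g - rho. *)

definition smrc_class :: "nat \<Rightarrow> nat \<Rightarrow> nat \<Rightarrow> rat poly" where
  "smrc_class g r d =
     smult (smrc_coeff g r d) (theta ^ nat (smrc_codim g r d + int g - rho g r d))"

(* Meaningful for rho - N >= 0, i.e. when the locus has non-negative expected dimension. *)

definition smrc_strictly_positive :: "nat \<Rightarrow> nat \<Rightarrow> nat \<Rightarrow> bool" where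
  "smrc_strictly_positive g r d \<longleftrightarrow>
     pic_degree g (smrc_class g r d * theta ^ nat (rho g r d - smrc_codim g r d)) > 0"

lemma smrc_strictly_positive_iff:
  assumes "d \<le> r + g" "smrc_codim g r d \<ge> 1" "rho g r d - smrc_codim g r d \<ge> 0"
  shows "smrc_strictly_positive g r d \<longleftrightarrow> smrc_coeff g r d > 0"
proof -
  let ?N = "smrc_codim g r d" and ?rho = "rho g r d"
  have "(int r + 1) * (int r + int g - int d) \<ge> 0"
    using assms(1) by (intro mult_nonneg_nonneg) auto
  then have "nat (?N + int g - ?rho) + nat (?rho - ?N) = g"
    using assms(2,3) by (simp add: rho_def)
  then have "theta ^ nat (?N + int g - ?rho) * theta ^ nat (?rho - ?N) = theta ^ g"
    by (simp flip: power_add)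
  then have "smrc_class g r d * theta ^ nat (?rho - ?N) = smult (smrc_coeff g r d) (theta ^ g)"
    by (simp add: smrc_class_def)
  then show ?thesis
    by (simp add: smrc_strictly_positive_def pic_degree_def theta_def monom_power zero_less_mult_iff)
qed

end

(* The coefficient is an alternating sum of a_k (-4)^(N-k) / (N-k)! over k <= N, where a_k >= 0 is the sum of
   D(I) V(I) / prod_j (i_j + s)! over the sequences I with deg(s_I) = k; here s = r + g - d, V is the
   Vandermonde product and D(I) is the determinant d_I up to a sign and a power of 2. D(I) >= 0 follows from
   a branching rule that removes vertical strips.

   Weighting one row of a determinant in all possible ways and adding up multiplies the determinant by the
   sum of the weights. Applied to D and to V, this relates a_k and a_(k+1):
   2 ((r+1)(r+2)/2 - k) a_k <= (k+1) (r+1+s+k) a_(k+1). The assumption rho >= N amounts to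
   (r-1)(r-2s) >= 4N - 2, so s < r/2, and therefore a_(k+1) > 4 a_k for all k < N as soon as r is large
   compared to N; then the alternating sum is positive. This covers r >= 12N - 2, and all but finitely many
   cases with N <= 7. In the remaining cases the sum is computed: by the branching rule, D satisfies a
   recursion in r on partitions of size at most N. *)
theory Submission
  imports Defs
begin

section \<open>Determinants with a weighted row\<close>

text \<open>The inequality between a_k and a_(k+1) has one lossy step. With n = r + 1, raising
  entries of D gives exactly 2 (n^2 - |I|), where n^2 is the sum of the odd numbers 2b + 1; lowering
  entries of V gives exactly k + 1. Only the extra factor i_a + s, left over from the factorials,
  depends on the row, and it is bounded by n + k + s. With s < r/2 and k < N, the resulting
  condition is in essence r^2 > 6 N r + 4 N^2, that is, r above roughly 6.6 N. So r >= 12 N - 2 is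
  comfortably inside, while for N = 7 everything up to r = 43 is left over, with determinants of
  order up to 44. Such determinants are never expanded. Only partitions of size at most N occur (45
  of them for N = 7, whatever r is), and a table of D for one r yields the table for the next. All
  other factors are made integral by a positive common multiple, since only the sign matters. The
  exceptional triples are outcomes of this computation: they are the pairs (r, s) at which the sum
  is found not to be positive.\<close>

lemma det_mat_permutes:
  "det (mat n n f) = (\<Sum>p | p permutes {0..<n}. of_int (sign p) * (\<Prod>i = 0..<n. f (i, p i)))"
proof -
  have "(\<Prod>i = 0..<n. mat n n f $$ (i, p i)) = (\<Prod>i = 0..<n. f (i, p i))"
    if "p permutes {0..<n}" for p
    using permutes_in_image[OF that] by (intro prod.cong) auto
  then show ?thesis
    by (subst det_def'[of _ n]) (auto intro!: sum.cong)
qed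

lemma det_mat_cong:
  assumes "\<And>i j. i < n \<Longrightarrow> j < n \<Longrightarrow> f (i, j) = g (i, j)"
  shows "det (mat n n f) = det (mat n n g)"
  using assms by (intro arg_cong[where f = det] eq_matI) auto

text \<open>In the Leibniz term of a permutation p, the weighted row a contributes
  \<open>x a + y (p a)\<close>. Summed over a this is the same for every p, so it factors out of the
  determinant.\<close>

lemma sum_det_weight_row:
  fixes A :: "nat \<Rightarrow> nat \<Rightarrow> 'a :: comm_ring_1"
  shows "(\<Sum>a<n. det (mat n n (\<lambda>(i, j). (if i = a then x i + y j else 1) * A i j))) =
         ((\<Sum>i<n. x i) + (\<Sum>j<n. y j)) * det (mat n n (\<lambda>(i, j). A i j))"
proof -
  have *: "(\<Sum>a<n. \<Prod>i = 0..<n. (if i = a then x i + y (p i) else 1) * A i (p i)) =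
           ((\<Sum>i<n. x i) + (\<Sum>j<n. y j)) * (\<Prod>i = 0..<n. A i (p i))"
    if p: "p permutes {0..<n}" for p
  proof -
    have "(\<Prod>i = 0..<n. (if i = a then x i + y (p i) else 1) * A i (p i)) =
          (x a + y (p a)) * (\<Prod>i = 0..<n. A i (p i))" if "a < n" for a
      using that by (simp add: prod.distrib)
    then have "(\<Sum>a<n. \<Prod>i = 0..<n. (if i = a then x i + y (p i) else 1) * A i (p i)) =
               (\<Sum>a<n. x a + y (p a)) * (\<Prod>i = 0..<n. A i (p i))"
      by (simp add: sum_distrib_right)
    also have "(\<Sum>a<n. y (p a)) = (\<Sum>j<n. y j)"
      using sum.permute[OF p, of y] by (simp add: atLeast0LessThan o_def)
    then have "(\<Sum>a<n. x a + y (p a)) = (\<Sum>i<n. x i) + (\<Sum>j<n. y j)"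
      by (simp add: sum.distrib)
    finally show ?thesis .
  qed
  show ?thesis
    unfolding det_mat_permutes prod.case
  proof (subst sum.swap, subst sum_distrib_left, intro sum.cong refl)
    fix p assume "p \<in> {p. p permutes {0..<n}}"
    then show "(\<Sum>a<n. of_int (sign p) * (\<Prod>i = 0..<n. (if i = a then x i + y (p i) else 1) * A i (p i))) =
      ((\<Sum>i<n. x i) + (\<Sum>j<n. y j)) * (of_int (sign p) * (\<Prod>i = 0..<n. A i (p i)))"
      unfolding sum_distrib_left[symmetric] using * by (simp add: mult.left_commute)
  qed
qed

text \<open>Column $b$ holds the coefficients of $(1+2t)^{2b+1}/4^b$. With this scaling, subtracting
  $1/4$ of a column from the next one produces $(t+t^2)(1+2t)^{2b+1}/4^b$: no factors
  remain in the branching rule \<open>sdet_Cons\<close> below.\<close>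

definition sdet :: "nat list \<Rightarrow> rat" where
  "sdet I = det (mat (length I) (length I)
     (\<lambda>(a, b). 2 ^ (I ! a) * of_nat ((2 * b + 1) choose (I ! a)) / 4 ^ b))"

lemma sum_odd: "(\<Sum>b<n. 2 * of_nat b + 1) = (of_nat n ^ 2 :: rat)"
  by (induction n) (auto simp: algebra_simps power2_eq_square)

lemma Suc_times_binomial_of_nat:
  "(of_nat (Suc i) :: 'a :: comm_ring_1) * of_nat (m choose Suc i) = (of_nat m - of_nat i) * of_nat (m choose i)"
proof (cases "i \<le> m")
  case True
  have "Suc i * (m choose Suc i) = (m - i) * (m choose i)"
  proof (cases m)
    case (Suc m')
    then show ?thesis
      by (simp only: Suc_times_binomial binomial_absorb_comp diff_Suc_1)
  qed simp
  then show ?thesis using True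
    by (metis of_nat_diff of_nat_mult)
qed (simp add: binomial_eq_0)

lemma det_mat_scale_row:
  fixes A :: "nat \<Rightarrow> nat \<Rightarrow> 'a :: comm_ring_1"
  assumes "a < n"
  shows "det (mat n n (\<lambda>(i, j). (if i = a then c else 1) * A i j)) = c * det (mat n n (\<lambda>(i, j). A i j))"
  using assms by (simp add: det_mat_permutes prod.distrib sum_distrib_left mult_ac)

text \<open>Since (i+1) C(m, i+1) = (m - i) C(m, i) with m = 2b + 1, raising entry a amounts to
  weighting row a by 2(2b+1) - 2 i_a, a column term plus a row term. The odd numbers 2b + 1 add up
  to n^2.\<close>

lemma sum_Suc_times_sdet:
  "(\<Sum>a<length I. of_nat (I ! a + 1) * sdet (I[a := I ! a + 1])) =
   2 * (of_nat (length I ^ 2) - of_nat (sum_list I)) * sdet I"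
proof -
  define n where "n = length I"
  define A where "A = (\<lambda>a b. 2 ^ (I ! a) * of_nat ((2 * b + 1) choose (I ! a)) / 4 ^ b :: rat)"
  define x where "x = (\<lambda>a. - 2 * of_nat (I ! a) :: rat)"
  define y where "y = (\<lambda>b. 2 * (2 * of_nat b + 1) :: rat)"
  have row: "of_nat (I ! a + 1) * sdet (I[a := I ! a + 1]) =
      det (mat n n (\<lambda>(i, j). (if i = a then x i + y j else 1) * A i j))"
    if "a < n" for a
  proof -
    define B where
      "B = (\<lambda>i j. 2 ^ (I[a := I ! a + 1] ! i) * of_nat ((2 * j + 1) choose (I[a := I ! a + 1] ! i)) / 4 ^ j :: rat)"
    have "of_nat (I ! a + 1) * sdet (I[a := I ! a + 1]) =
       det (mat n n (\<lambda>(i, j). (if i = a then of_nat (I ! a + 1) else 1) * B i j))"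
      unfolding det_mat_scale_row[OF that] by (simp add: sdet_def n_def B_def)
    also have "\<dots> = det (mat n n (\<lambda>(i, j). (if i = a then x i + y j else 1) * A i j))"
    proof (rule det_mat_cong, goal_cases)
      case (1 i j)
      have "(of_nat (I ! a + 1) :: rat) * of_nat ((2 * j + 1) choose (I ! a + 1)) =
            (of_nat (2 * j + 1) - of_nat (I ! a)) * of_nat ((2 * j + 1) choose (I ! a))"
        using Suc_times_binomial_of_nat[of "I ! a" "2 * j + 1"] by simp
      then have "2 * 2 ^ (I ! a) / 4 ^ j * (of_nat (I ! a + 1) * of_nat ((2 * j + 1) choose (I ! a + 1)) :: rat) =
            2 * 2 ^ (I ! a) / 4 ^ j * ((of_nat (2 * j + 1) - of_nat (I ! a)) * of_nat ((2 * j + 1) choose (I ! a)))"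
        by simp
      also have "\<dots> = (x a + y j) * A a j"
        by (simp add: x_def y_def A_def algebra_simps add_divide_distrib diff_divide_distrib)
      finally have "of_nat (I ! a + 1) * (2 ^ (I ! a + 1) * of_nat ((2 * j + 1) choose (I ! a + 1)) / 4 ^ j) =
            (x a + y j) * A a j"
        by (simp add: mult_ac del: binomial_Suc_Suc of_nat_Suc)
      then show ?case
        using that by (auto simp: A_def B_def n_def nth_list_update)
    qed
    finally show ?thesis .
  qed
  have "(\<Sum>j<n. y j) = 2 * of_nat (n ^ 2)"
    unfolding y_def sum_distrib_left[symmetric] sum_odd by simp
  moreover have "(\<Sum>i<n. x i) = - 2 * of_nat (sum_list I)"
    by (simp add: x_def n_def sum_list_sum_nth atLeast0LessThan sum_distrib_left)
  moreover have "sdet I = det (mat n n (\<lambda>(i, j). A i j))"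
    by (simp add: sdet_def n_def A_def)
  moreover have "(\<Sum>a<n. of_nat (I ! a + 1) * sdet (I[a := I ! a + 1])) =
      (\<Sum>a<n. det (mat n n (\<lambda>(i, j). (if i = a then x i + y j else 1) * A i j)))"
    using row by (intro sum.cong) auto
  ultimately show ?thesis
    unfolding n_def[symmetric] sum_det_weight_row by (simp add: algebra_simps)
qed

section \<open>Vandermonde determinants in arbitrary Newton bases\<close>

definition vdm :: "nat \<Rightarrow> (nat \<Rightarrow> 'a :: comm_ring_1) \<Rightarrow> 'a" where
  "vdm n x = (\<Prod>l<n. \<Prod>j<l. x l - x j)"

lemma det_monic_poly:
  fixes x :: "nat \<Rightarrow> 'a :: comm_ring_1"
  assumes "\<And>b. b < n \<Longrightarrow> degree (p b) = b" and "\<And>b. b < n \<Longrightarrow> lead_coeff (p b) = 1"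
  shows "det (mat n n (\<lambda>(a, b). poly (p b) (x a))) = det (mat n n (\<lambda>(a, b). x a ^ b))"
proof -
  let ?T = "mat n n (\<lambda>(i, j). coeff (p j) i)" and ?V = "mat n n (\<lambda>(a, b). x a ^ b)"
  have "mat n n (\<lambda>(a, b). poly (p b) (x a)) = ?V * ?T"
  proof (rule eq_matI, goal_cases)
    case (1 a b)
    then have "poly (p b) (x a) = (\<Sum>i<n. coeff (p b) i * x a ^ i)"
      unfolding poly_altdef using assms(1)[of b]
      by (intro sum.mono_neutral_left) (auto simp: coeff_eq_0)
    with 1 show ?case
      by (simp add: scalar_prod_def atLeast0LessThan mult.commute)
  qed auto
  also have "det \<dots> = det ?V * det ?T"
    by (rule det_mult) auto
  also have "det ?T = 1"
  proof (subst det_upper_triangular[of _ n])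
    show "upper_triangular ?T"
      using assms(1) by (auto simp: upper_triangular_def coeff_eq_0)
    show "prod_list (diag_mat ?T) = 1"
      using assms by (auto simp: diag_mat_def simp: prod.list_conv_set_nth)
  qed auto
  finally show ?thesis by simp
qed

text \<open>Passing between monic bases is a unitriangular column operation, so the nodes
  \<open>y\<close> are free; the choice y = x makes the matrix triangular. Later uses take the nodes
  0, 1, 2, ... (falling factorials) and the constant node 0 (monomials).\<close>

lemma det_newton_basis:
  fixes x y :: "nat \<Rightarrow> 'a :: idom"
  shows "det (mat n n (\<lambda>(a, b). \<Prod>j<b. x a - y j)) = vdm n x"
proof -
  define p :: "(nat \<Rightarrow> 'a) \<Rightarrow> nat \<Rightarrow> 'a poly" where "p = (\<lambda>y b. \<Prod>j<b. [: - y j, 1 :])"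
  have poly: "poly (p w b) z = (\<Prod>j<b. z - w j)" for w b z
    by (simp add: p_def poly_prod)
  have monic: "degree (p w b) = b" "lead_coeff (p w b) = 1" for w b
  proof -
    show "degree (p w b) = b"
      unfolding p_def by (subst degree_prod_eq_sum_degree) auto
    show "lead_coeff (p w b) = 1"
      unfolding p_def lead_coeff_prod by simp
  qed
  have "det (mat n n (\<lambda>(a, b). \<Prod>j<b. x a - y j)) = det (mat n n (\<lambda>(a, b). poly (p y b) (x a)))"
    by (simp add: poly)
  also have "\<dots> = det (mat n n (\<lambda>(a, b). poly (p x b) (x a)))"
    using monic by (simp add: det_monic_poly)
  also have "\<dots> = vdm n x"
  proof (subst det_lower_triangular[of n])
    show "mat n n (\<lambda>(a, b). poly (p x b) (x a)) $$ (i, j) = 0" if "i < j" "j < n" for i j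
      using that by (auto simp: poly)
    show "prod_list (diag_mat (mat n n (\<lambda>(a, b). poly (p x b) (x a)))) = vdm n x"
      by (simp add: diag_mat_def prod.list_conv_set_nth poly vdm_def atLeast0LessThan)
  qed auto
  finally show ?thesis .
qed

text \<open>In the basis of falling factorials, x (x-1)(x-2)...(x-b) is (x - b) times the entry of
  column b. Lowering \<open>x a\<close> thus weights row a by x_a - b, again a row term plus a
  column term.\<close>

lemma sum_vdm_lower:
  fixes x :: "nat \<Rightarrow> 'a :: idom"
  shows "(\<Sum>a<n. x a * vdm n (x(a := x a - 1))) = ((\<Sum>a<n. x a) - (\<Sum>b<n. of_nat b)) * vdm n x"
proof -
  define A where "A = (\<lambda>a b. \<Prod>j<b. x a - of_nat j)"
  have "x a * vdm n (x(a := x a - 1)) = det (mat n n (\<lambda>(i, j). (if i = a then x i + - of_nat j else 1) * A i j))"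
    if "a < n" for a
  proof -
    have *: "x a * (\<Prod>j<b. x a - 1 - of_nat j) = (x a - of_nat b) * A a b" for b
      unfolding A_def prod.lessThan_Suc[symmetric, of "\<lambda>j. x a - of_nat j", simplified mult.commute]
      by (simp add: prod.lessThan_Suc_shift algebra_simps del: prod.lessThan_Suc)
    have "x a * vdm n (x(a := x a - 1)) = det (mat n n (\<lambda>(i, b). (if i = a then x a else 1) * (\<Prod>j<b. (x(a := x a - 1)) i - of_nat j)))"
      using det_mat_scale_row[OF that, of "x a" "\<lambda>i b. \<Prod>j<b. (x(a := x a - 1)) i - of_nat j"]
      by (simp add: det_newton_basis fun_upd_def)
    also have "\<dots> = det (mat n n (\<lambda>(i, j). (if i = a then x i + - of_nat j else 1) * A i j))"
      by (rule det_mat_cong) (auto simp: * A_def)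
    finally show ?thesis .
  qed
  then have "(\<Sum>a<n. x a * vdm n (x(a := x a - 1))) =
      (\<Sum>a<n. det (mat n n (\<lambda>(i, j). (if i = a then x i + - of_nat j else 1) * A i j)))"
    by (intro sum.cong) auto
  also have "\<dots> = ((\<Sum>a<n. x a) - (\<Sum>b<n. of_nat b)) * det (mat n n (\<lambda>(i, j). A i j))"
    unfolding sum_det_weight_row by (simp add: sum_negf)
  finally show ?thesis
    unfolding A_def det_newton_basis .
qed

section \<open>The branching rule\<close>

lemma det_mat_sum_rows:
  fixes A :: "'c \<Rightarrow> nat \<Rightarrow> nat \<Rightarrow> 'a :: comm_ring_1"
  assumes "finite Z"
  shows "det (mat n n (\<lambda>(i, j). \<Sum>z\<in>Z. A z i j)) =
         (\<Sum>f\<in>{0..<n} \<rightarrow>\<^sub>E Z. det (mat n n (\<lambda>(i, j). A (f i) i j)))"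
proof -
  have "(\<Sum>p | p permutes {0..<n}. of_int (sign p) * (\<Prod>i = 0..<n. \<Sum>z\<in>Z. A z i (p i))) =
      (\<Sum>p | p permutes {0..<n}. \<Sum>f\<in>{0..<n} \<rightarrow>\<^sub>E Z. of_int (sign p) * (\<Prod>i = 0..<n. A (f i) i (p i)))"
    using assms by (simp add: prod_sum_PiE sum_distrib_left)
  then show ?thesis
    unfolding det_mat_permutes prod.case by (simp add: sum.swap[of _ _ "{p. p permutes {0..<n}}"])
qed

lemma sdet_not_distinct:
  assumes "\<not> distinct I"
  shows "sdet I = 0"
proof -
  obtain i j where ij: "i < length I" "j < length I" "i \<noteq> j" "I ! i = I ! j"
    using assms by (auto simp: distinct_conv_nth)
  show ?thesis
    unfolding sdet_def
    by (rule det_identical_rows[OF _ ij(3,1,2)]) (use ij in \<open>auto intro!: eq_vecI\<close>)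
qed

text \<open>The decrements 1 and 2 are the exponents in the factor t + t^2 that the column operation
  leaves behind.\<close>

definition strip_preds :: "nat list \<Rightarrow> nat list set" where
  "strip_preds I = {J. length J = length I \<and> sorted_wrt (<) J \<and>
     (\<forall>a < length I. I ! a = J ! a + 1 \<or> I ! a = J ! a + 2)}"

lemma finite_strip_preds: "finite (strip_preds I)"
proof (rule finite_subset)
  show "strip_preds I \<subseteq> {J. set J \<subseteq> {..Max (insert 0 (set I))} \<and> length J = length I}"
  proof
    fix J assume J: "J \<in> strip_preds I"
    have "J ! a \<le> Max (insert 0 (set I))" if "a < length I" for a
    proof -
      have "J ! a \<le> I ! a"
        using J that unfolding strip_preds_def by fastforce
      also have "\<dots> \<le> Max (insert 0 (set I))"
        using that by simp
      finally show ?thesis .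
    qed
    with J show "J \<in> {J. set J \<subseteq> {..Max (insert 0 (set I))} \<and> length J = length I}"
      by (auto simp: strip_preds_def in_set_conv_nth)
  qed
qed (rule finite_lists_length_eq, simp)

text \<open>Coefficient of t^i in the identity (1+2t)^2 - 1 = 4 (t + t^2), multiplied by
  (1+2t)^(2b+1) / 4^(b+1).\<close>

lemma sdet_entry_diff:
  fixes b i :: nat
  defines "h \<equiv> \<lambda>i b. 2 ^ i * of_nat ((2 * b + 1) choose i) / 4 ^ b :: rat"
  shows "h i (Suc b) - h i b / 4 = (\<Sum>z\<in>{1, 2}. if z \<le> i then h (i - z) b else 0)"
proof -
  consider "i = 0" | "i = 1" | j where "i = Suc (Suc j)"
    by (metis One_nat_def not0_implies_Suc)
  then show ?thesis
  proof cases
    case 3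
    have "Suc (Suc m) choose Suc (Suc j) = (m choose Suc (Suc j)) + 2 * (m choose Suc j) + (m choose j)" for m
      by simp
    from this[of "Suc (2 * b)"] show ?thesis
      by (simp add: h_def 3 field_simps del: binomial_Suc_Suc)
  qed (auto simp: h_def field_simps)
qed

text \<open>Multilinearity expands the rows over all choices of decrements 1 or 2. A decrement
  larger than the entry gives a zero row. Otherwise gaps of at least 1 shrink by at most 1, so the
  lowered sequence is still weakly increasing; if it is not strict, two rows coincide. What survives
  is exactly \<open>strip_preds I\<close>.\<close>

lemma sdet_minor:
  assumes "sorted_wrt (<) I"
  defines "h \<equiv> \<lambda>i b. 2 ^ i * of_nat ((2 * b + 1) choose i) / 4 ^ b :: rat"
  defines "n \<equiv> length I"
  shows "det (mat n n (\<lambda>(a, b). \<Sum>z\<in>{1, 2}. if z \<le> I ! a then h (I ! a - z) b else 0)) =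
         (\<Sum>J\<in>strip_preds I. sdet J)"
proof -
  define A where "A = (\<lambda>z a b. if z \<le> I ! a then h (I ! a - z) b else 0)"
  define D where "D = (\<lambda>f. det (mat n n (\<lambda>(a, b). A (f a) a b)))"
  define F where "F = {0..<n} \<rightarrow>\<^sub>E {1, 2 :: nat}"
  define down where "down = (\<lambda>f. map (\<lambda>a. I ! a - f a) [0..<n])"
  define good where "good = (\<lambda>f. (\<forall>a<n. f a \<le> I ! a) \<and> sorted_wrt (<) (down f))"
  have D_down: "D f = sdet (down f)" if "\<forall>a<n. f a \<le> I ! a" for f
    unfolding D_def sdet_def down_def using that
    by (auto simp: A_def h_def intro!: det_mat_cong)
  have "det (mat n n (\<lambda>(a, b). \<Sum>z\<in>{1, 2}. A z a b)) = (\<Sum>f\<in>F. D f)"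
    unfolding F_def D_def by (rule det_mat_sum_rows) simp
  also have "\<dots> = (\<Sum>f\<in>{f \<in> F. good f}. D f)"
  proof (rule sum.mono_neutral_right)
    show "finite F"
      by (simp add: F_def finite_PiE)
    show "\<forall>f\<in>F - {f \<in> F. good f}. D f = 0"
    proof
      fix f assume f_bad: "f \<in> F - {f \<in> F. good f}"
      show "D f = 0"
      proof (cases "\<forall>a<n. f a \<le> I ! a")
        case True
        have f: "f a = 1 \<or> f a = 2" if "a < n" for a
          using that f_bad by (auto simp: F_def PiE_def Pi_def)
        have "sorted (down f)"
          unfolding sorted_iff_nth_mono_less
        proof (intro allI impI)
          fix a b assume ab: "a < b" "b < length (down f)"
          then have "I ! a < I ! b"
            using assms(1) by (simp add: sorted_wrt_iff_nth_less down_def n_def)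
          then show "down f ! a \<le> down f ! b"
            using ab f[of a] f[of b] True by (auto simp: down_def)
        qed
        then have "\<not> distinct (down f)"
          using f_bad True by (auto simp: good_def strict_sorted_iff)
        then show ?thesis
          by (simp add: D_down True sdet_not_distinct)
      next
        case False
        then obtain a where a: "a < n" "\<not> f a \<le> I ! a" by auto
        then have "D f = det (mat n n (\<lambda>(i, b). (if i = a then 0 else 1) * A (f i) i b))"
          unfolding D_def by (intro det_mat_cong) (auto simp: A_def)
        then show ?thesis
          using det_mat_scale_row[OF a(1), of 0 "\<lambda>a b. A (f a) a b"] by simp
      qed
    qed
  qed auto
  also have "\<dots> = (\<Sum>J\<in>strip_preds I. sdet J)"
  proof (rule sum.reindex_bij_witness[where j = down and i = "\<lambda>J. \<lambda>a\<in>{0..<n}. I ! a - J ! a"])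
    fix f assume f: "f \<in> {f \<in> F. good f}"
    show "(\<lambda>a\<in>{0..<n}. I ! a - down f ! a) = f"
    proof
      fix a show "(\<lambda>a\<in>{0..<n}. I ! a - down f ! a) a = f a"
        using f by (cases "a < n") (auto simp: F_def good_def down_def PiE_def extensional_def)
    qed
    have "f a = 1 \<or> f a = 2" if "a < n" for a
      using that f by (auto simp: F_def PiE_def Pi_def)
    with f show "down f \<in> strip_preds I"
      by (fastforce simp: strip_preds_def good_def down_def n_def)
    show "sdet (down f) = D f"
      using f by (simp add: D_down good_def)
  next
    fix J assume J: "J \<in> strip_preds I"
    show *: "down (\<lambda>a\<in>{0..<n}. I ! a - J ! a) = J"
    proof (rule nth_equalityI)
      show "length (down (\<lambda>a\<in>{0..<n}. I ! a - J ! a)) = length J"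
        using J by (simp add: down_def strip_preds_def n_def)
      fix a assume "a < length (down (\<lambda>a\<in>{0..<n}. I ! a - J ! a))"
      then have "a < n" by (simp add: down_def)
      then show "down (\<lambda>a\<in>{0..<n}. I ! a - J ! a) ! a = J ! a"
        using J by (auto simp: down_def strip_preds_def n_def)
    qed
    then show "(\<lambda>a\<in>{0..<n}. I ! a - J ! a) \<in> {f \<in> F. good f}"
      using J by (fastforce simp: F_def good_def strip_preds_def n_def)
  qed
  finally show ?thesis
    by (simp add: A_def)
qed

text \<open>The unitriangular \<open>?T\<close> subtracts 1/4 of each column from the next. Column 0
  keeps the coefficients 1, 2, 0, 0, ... of 1 + 2t, which explains the leading factor. For i = 0 the
  first row is zero beyond column 0, because t + t^2 has no constant term. For i > 0 all later
  entries exceed 1, so column 0 is zero below the first row. Either way one Laplace term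
  remains.\<close>

lemma sdet_Cons:
  assumes "sorted_wrt (<) (i # I)"
  shows "sdet (i # I) = (if i = 0 then 1 else if i = 1 then 2 else 0) * (\<Sum>J\<in>strip_preds I. sdet J)"
proof -
  define h where "h = (\<lambda>i b. 2 ^ i * of_nat ((2 * b + 1) choose i) / 4 ^ b :: rat)"
  define n where "n = length I"
  define K where "K = i # I"
  let ?A = "mat (Suc n) (Suc n) (\<lambda>(a, b). h (K ! a) b)"
  let ?T = "mat (Suc n) (Suc n) (\<lambda>(i, j). if i = j then 1 else if Suc i = j then - 1 / 4 else 0 :: rat)"
  define B where "B = mat (Suc n) (Suc n) (\<lambda>(a, b). case b of 0 \<Rightarrow> h (K ! a) 0 |
      Suc b' \<Rightarrow> (\<Sum>z\<in>{1, 2}. if z \<le> K ! a then h (K ! a - z) b' else 0))"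
  have K: "K ! a > i" if "0 < a" "a < Suc n" for a
    using assms that by (cases a) (auto simp: K_def n_def)
  have entry: "h i (Suc b) - h i b / 4 = (\<Sum>z\<in>{1, 2}. if z \<le> i then h (i - z) b else 0)" for i b
    unfolding h_def by (rule sdet_entry_diff)
  have "?A * ?T = B"
  proof (rule eq_matI, goal_cases)
    case (1 a b)
    then have ab: "a < Suc n" "b < Suc n" by (auto simp: B_def)
    have "(?A * ?T) $$ (a, b) = (\<Sum>k<Suc n. h (K ! a) k * (if k = b then 1 else if Suc k = b then - 1 / 4 else 0))"
      using ab by (simp add: scalar_prod_def atLeast0LessThan del: sum.lessThan_Suc)
    also have "\<dots> = (\<Sum>k\<in>{k. k = b \<or> Suc k = b}. h (K ! a) k * (if k = b then 1 else if Suc k = b then - 1 / 4 else 0))"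
      using ab by (intro sum.mono_neutral_right) auto
    also have "\<dots> = B $$ (a, b)"
    proof (cases b)
      case (Suc c)
      then have "{k. k = b \<or> Suc k = b} = {b, c}" by auto
      with Suc ab show ?thesis
        using entry[of "K ! a" c] by (simp add: B_def)
    qed (use ab in \<open>simp add: B_def\<close>)
    finally show ?case .
  qed (auto simp: B_def)
  moreover have "det (?A * ?T) = det ?A * det ?T"
    by (rule det_mult) auto
  moreover have "det ?T = 1"
    by (subst det_upper_triangular[of _ "Suc n"])
       (auto simp: upper_triangular_def diag_mat_def prod.list_conv_set_nth simp del: upt_Suc)
  moreover have "sdet (i # I) = det ?A"
    by (simp add: sdet_def n_def K_def h_def)
  ultimately have det_B: "sdet (i # I) = det B"
    by simp
  have carrier: "B \<in> carrier_mat (Suc n) (Suc n)"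
    by (simp add: B_def)
  have "mat_delete B 0 0 = mat n n (\<lambda>(a, b). \<Sum>z\<in>{1, 2}. if z \<le> I ! a then h (I ! a - z) b else 0)"
    by (rule eq_matI) (auto simp: mat_delete_def B_def K_def)
  moreover have "det \<dots> = (\<Sum>J\<in>strip_preds I. sdet J)"
    unfolding h_def n_def by (rule sdet_minor) (use assms in simp)
  ultimately have minor: "cofactor B 0 0 = (\<Sum>J\<in>strip_preds I. sdet J)"
    by (simp only: cofactor_def) simp
  show ?thesis
  proof (cases "i = 0")
    case True
    have "det B = (\<Sum>b<Suc n. B $$ (0, b) * cofactor B 0 b)"
      by (rule laplace_expansion_row[OF carrier]) simp
    also have "\<dots> = (\<Sum>b\<in>{0}. B $$ (0, b) * cofactor B 0 b)"
      using True by (intro sum.mono_neutral_right) (auto simp: B_def K_def split: nat.splits)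
    finally have "sdet (i # I) = B $$ (0, 0) * (\<Sum>J\<in>strip_preds I. sdet J)"
      by (simp add: det_B minor)
    then show ?thesis
      using True by (simp add: B_def K_def h_def)
  next
    case False
    have "det B = (\<Sum>a<Suc n. B $$ (a, 0) * cofactor B a 0)"
      by (rule laplace_expansion_column[OF carrier]) simp
    also have "\<dots> = (\<Sum>a\<in>{0}. B $$ (a, 0) * cofactor B a 0)"
      using False K by (intro sum.mono_neutral_right) (force simp: B_def h_def binomial_eq_0)+
    finally have "sdet (i # I) = B $$ (0, 0) * (\<Sum>J\<in>strip_preds I. sdet J)"
      by (simp add: det_B minor)
    then show ?thesis
      using False by (auto simp: B_def K_def h_def binomial_eq_0)
  qed
qed

lemma sdet_Nil: "sdet [] = 1"
  by (simp add: sdet_def)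

lemma sdet_nonneg: "sorted_wrt (<) I \<Longrightarrow> sdet I \<ge> 0"
proof (induction "length I" arbitrary: I)
  case (Suc n)
  then obtain i I' where I: "I = i # I'" by (cases I) auto
  then show ?case
    using Suc by (auto simp: sdet_Cons strip_preds_def intro!: mult_nonneg_nonneg sum_nonneg)
qed (simp add: sdet_Nil)

section \<open>The terms of the alternating sum\<close>

definition strict_lists :: "nat \<Rightarrow> nat \<Rightarrow> nat list set" where
  "strict_lists n K = {I. length I = n \<and> sorted_wrt (<) I \<and> sum_list I = K}"

lemma finite_strict_lists: "finite (strict_lists n K)"
proof (rule finite_subset)
  show "strict_lists n K \<subseteq> {I. set I \<subseteq> {..K} \<and> length I = n}"
    using member_le_sum_list by (auto simp: strict_lists_def)
qed (rule finite_lists_length_eq, simp)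

lemma nth_strict_ge: "sorted_wrt (<) I \<Longrightarrow> a < length I \<Longrightarrow> a \<le> I ! a"
proof (induction a)
  case (Suc a)
  then have "I ! a < I ! Suc a"
    by (auto simp: sorted_wrt_iff_nth_less)
  with Suc show ?case by simp
qed simp

lemma sum_upto_choose: "(\<Sum>b<n. b) = n choose 2"
  by (induction n) (auto simp: numeral_2_eq_2)

lemma strict_lists_choose_le: "I \<in> strict_lists n K \<Longrightarrow> n choose 2 \<le> K"
  using nth_strict_ge[of I]
  by (auto simp: strict_lists_def sum_list_sum_nth atLeast0LessThan simp flip: sum_upto_choose intro!: sum_mono)

lemma nth_strict_lists_le:
  assumes "I \<in> strict_lists n ((n choose 2) + k)" "a < n"
  shows "I ! a \<le> a + k"
proof -
  have "(\<Sum>b<n. b) + (I ! a - a) = (\<Sum>b<n. b + (if b = a then I ! a - a else 0))"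
    using assms(2) by (simp add: sum.distrib)
  also have "\<dots> \<le> (\<Sum>b<n. I ! b)"
    using assms nth_strict_ge[of I] by (intro sum_mono) (auto simp: strict_lists_def)
  also have "\<dots> = (\<Sum>b<n. b) + k"
    using assms by (auto simp: strict_lists_def sum_list_sum_nth atLeast0LessThan sum_upto_choose)
  finally show ?thesis by simp
qed

definition schur_weight :: "nat \<Rightarrow> nat list \<Rightarrow> rat" where
  "schur_weight s I = vdm (length I) (\<lambda>a. of_nat (I ! a)) / (\<Prod>a<length I. fact (I ! a + s))"

definition sdet_sum :: "nat \<Rightarrow> nat \<Rightarrow> nat \<Rightarrow> rat" where
  "sdet_sum n s K = (\<Sum>I\<in>strict_lists n K. sdet I * schur_weight s I)"

lemma vdm_nonneg:
  fixes x :: "nat \<Rightarrow> 'a :: linordered_idom"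
  assumes "\<And>i j. i < j \<Longrightarrow> j < n \<Longrightarrow> x i \<le> x j"
  shows "vdm n x \<ge> 0"
  unfolding vdm_def using assms by (intro prod_nonneg) auto

lemma vdm_eq_0:
  assumes "i < j" "j < n" "x i = x j"
  shows "vdm n x = 0"
proof -
  have "(\<Prod>i'<j. x j - x i') = 0"
    using assms by (intro prod_zero bexI[of _ i]) auto
  with assms show ?thesis
    unfolding vdm_def by (intro prod_zero) auto
qed

lemma sum_list_update_Suc:
  "a < length I \<Longrightarrow> sum_list (I[a := I ! a + 1]) = Suc (sum_list (I :: nat list))"
  using elem_le_sum_list[of a I] by (simp add: sum_list_update)

text \<open>The determinant expands upwards and the Vandermonde product downwards under the addition of a
  box, so both sides are the same sum over pairs of sequences that differ by one box.\<close>

lemma raise_sdet_sum: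
  "2 * (of_nat (n ^ 2) - of_nat K) * sdet_sum n s K =
   (\<Sum>J\<in>strict_lists n (Suc K). sdet J *
      (\<Sum>a<n. of_nat (J ! a) * of_nat (J ! a + s) *
         vdm n ((\<lambda>b. of_nat (J ! b))(a := of_nat (J ! a) - 1))) / (\<Prod>a<n. fact (J ! a + s)))"
proof -
  define up where "up = (\<lambda>(I :: nat list, a). (I[a := I ! a + 1], a))"
  define down where "down = (\<lambda>(J :: nat list, a). (J[a := J ! a - 1], a))"
  define S where "S = strict_lists n K \<times> {..<n}"
  define T where "T = strict_lists n (Suc K) \<times> {..<n}"
  define g where "g = (\<lambda>(I, a). of_nat (I ! a + 1) * sdet (I[a := I ! a + 1]) * schur_weight s I)"
  define h where "h = (\<lambda>(J, a). sdet J * (of_nat (J ! a) * of_nat (J ! a + s) *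
         vdm n ((\<lambda>b. of_nat (J ! b))(a := of_nat (J ! a) - 1)) / (\<Prod>a<n. fact (J ! a + s))))"
  have "2 * (of_nat (n ^ 2) - of_nat K) * sdet_sum n s K =
      (\<Sum>I\<in>strict_lists n K. 2 * (of_nat (n ^ 2) - of_nat K) * sdet I * schur_weight s I)"
    by (simp add: sdet_sum_def sum_distrib_left mult.assoc)
  also have "\<dots> = (\<Sum>I\<in>strict_lists n K. \<Sum>a<n. g (I, a))"
  proof (rule sum.cong[OF refl])
    fix I assume "I \<in> strict_lists n K"
    then have "length I = n" "sum_list I = K" by (auto simp: strict_lists_def)
    then show "2 * (of_nat (n ^ 2) - of_nat K) * sdet I * schur_weight s I = (\<Sum>a<n. g (I, a))"
      using sum_Suc_times_sdet[of I] by (simp add: g_def flip: sum_distrib_right)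
  qed
  also have "\<dots> = (\<Sum>x\<in>S. g x)"
    by (simp add: S_def sum.cartesian_product)
  also have "\<dots> = (\<Sum>x\<in>T. h x)"
  \<comment> \<open>Unpaired terms vanish: a raised sequence with a repetition has
    \<open>sdet\<close> 0, a lowered one has \<open>vdm\<close> 0. Pairs with
    \<open>J ! a = 0\<close> are set apart because \<open>down\<close> would truncate there; they
    vanish through the factor \<open>J ! a\<close>.\<close>
  proof (rule sum.reindex_bij_witness_not_neutral[where j = up and i = down
        and S' = "{x \<in> S. up x \<notin> T}" and T' = "{x \<in> T. snd (x) < n \<and> (fst x ! snd x = 0 \<or> down x \<notin> S)}"])
    show "finite {x \<in> S. up x \<notin> T}" "finite {x \<in> T. snd x < n \<and> (fst x ! snd x = 0 \<or> down x \<notin> S)}"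
      by (auto simp: S_def T_def finite_strict_lists)
    show *: "down (up x) = x" if "x \<in> S - {x \<in> S. up x \<notin> T}" for x
      using that by (auto simp: S_def down_def up_def strict_lists_def)
    show "up x \<in> T - {x \<in> T. snd x < n \<and> (fst x ! snd x = 0 \<or> down x \<notin> S)}"
      if "x \<in> S - {x \<in> S. up x \<notin> T}" for x
      using that *[OF that] by (auto simp: up_def S_def strict_lists_def split: prod.splits)
    show **: "up (down x) = x" if "x \<in> T - {x \<in> T. snd x < n \<and> (fst x ! snd x = 0 \<or> down x \<notin> S)}" for x
      using that by (auto simp: T_def down_def up_def strict_lists_def)
    show "down x \<in> S - {x \<in> S. up x \<notin> T}"
      if "x \<in> T - {x \<in> T. snd x < n \<and> (fst x ! snd x = 0 \<or> down x \<notin> S)}" for x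
      using that **[OF that] by (auto simp: T_def)
    show "g x = 0" if "x \<in> {x \<in> S. up x \<notin> T}" for x
    proof -
      obtain I a where x: "x = (I, a)" by (cases x)
      with that have I: "sorted_wrt (<) I" "length I = n" "sum_list I = K" "a < n"
        "\<not> sorted_wrt (<) (I[a := I ! a + 1])"
        by (auto simp: S_def T_def up_def strict_lists_def sum_list_update_Suc[simplified])
      have "sorted (I[a := I ! a + 1])"
        unfolding sorted_iff_nth_mono_less
      proof (intro allI impI)
        fix i j assume "i < j" "j < length (I[a := I ! a + 1])"
        moreover from this have "I ! i < I ! j"
          using I(1) by (simp add: sorted_wrt_iff_nth_less)
        ultimately show "I[a := I ! a + 1] ! i \<le> I[a := I ! a + 1] ! j"
          using I(2,4) by (auto simp: nth_list_update)
      qed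
      then have "\<not> distinct (I[a := I ! a + 1])"
        using I(5) by (simp add: strict_sorted_iff)
      then show ?thesis
        by (simp add: x g_def sdet_not_distinct)
    qed
    show "h x = 0" if x_in: "x \<in> {x \<in> T. snd x < n \<and> (fst x ! snd x = 0 \<or> down x \<notin> S)}" for x
    proof -
      obtain J a where x: "x = (J, a)" by (cases x)
      show ?thesis
      proof (cases "J ! a = 0")
        case False
        with x_in x have J: "sorted_wrt (<) J" "length J = n" "sum_list J = Suc K" "a < n"
          "J[a := J ! a - 1] \<notin> strict_lists n K"
          by (auto simp: S_def T_def down_def strict_lists_def)
        have "sum_list (J[a := J ! a - 1]) = K"
          using J False elem_le_sum_list[of a J] by (simp add: sum_list_update)
        with J have "\<not> sorted_wrt (<) (J[a := J ! a - 1])"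
          by (auto simp: strict_lists_def)
        moreover have "sorted (J[a := J ! a - 1])"
          unfolding sorted_iff_nth_mono_less
        proof (intro allI impI)
          fix i j assume "i < j" "j < length (J[a := J ! a - 1])"
          moreover from this have "J ! i < J ! j"
            using J(1) by (simp add: sorted_wrt_iff_nth_less)
          ultimately show "J[a := J ! a - 1] ! i \<le> J[a := J ! a - 1] ! j"
            using J(2,4) by (auto simp: nth_list_update)
        qed
        ultimately have "\<not> distinct (J[a := J ! a - 1])"
          by (simp add: strict_sorted_iff)
        then obtain i j where "i < j" "j < n" "J[a := J ! a - 1] ! i = J[a := J ! a - 1] ! j"
          using J(2) by (auto simp: distinct_conv_nth) (metis linorder_neqE_nat)
        then have "((\<lambda>b. of_nat (J ! b) :: rat)(a := of_nat (J ! a) - 1)) i =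
            ((\<lambda>b. of_nat (J ! b))(a := of_nat (J ! a) - 1)) j"
          using False J(2,4) by (auto simp: nth_list_update of_nat_diff split: if_splits)
        with \<open>i < j\<close> \<open>j < n\<close> have "vdm n ((\<lambda>b. of_nat (J ! b) :: rat)(a := of_nat (J ! a) - 1)) = 0"
          by (rule vdm_eq_0)
        then show ?thesis by (simp add: x h_def)
      qed (simp add: x h_def)
    qed
    show "h (up x) = g x" if "x \<in> S" for x
    proof -
      obtain I a where x: "x = (I, a)" by (cases x)
      with that have I: "length I = n" "a < n"
        by (auto simp: S_def strict_lists_def)
      have "(\<Prod>b<n. fact (I[a := I ! a + 1] ! b + s) :: rat) =
          (\<Prod>b<n. (if b = a then of_nat (I ! a + 1 + s) else 1) * fact (I ! b + s))"
        using I by (intro prod.cong) (auto simp: nth_list_update)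
      also have "\<dots> = of_nat (I ! a + 1 + s) * (\<Prod>b<n. fact (I ! b + s))"
        using I by (simp add: prod.distrib)
      finally have prod: "(\<Prod>b<n. fact (I[a := I ! a + 1] ! b + s) :: rat) =
          of_nat (I ! a + 1 + s) * (\<Prod>b<n. fact (I ! b + s))" .
      have "vdm n ((\<lambda>b. of_nat (I[a := I ! a + 1] ! b) :: rat)(a := of_nat (I[a := I ! a + 1] ! a) - 1)) =
          vdm n (\<lambda>b. of_nat (I ! b))"
        using I by (intro arg_cong[where f = "vdm n"]) (auto simp: nth_list_update)
      moreover have "u * (y * c * v / (c * P)) = y * u * (v / P)" if "c \<noteq> 0" for u y c v P :: rat
        using that by simp
      moreover have "of_nat (I ! a + 1 + s) \<noteq> (0 :: rat)"
        by (simp only: of_nat_eq_0_iff)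
      ultimately show ?thesis
        by (simp only: x g_def h_def up_def prod.case prod schur_weight_def I nth_list_update_eq)
    qed
  qed
  also have "\<dots> = (\<Sum>J\<in>strict_lists n (Suc K). \<Sum>a<n. h (J, a))"
    by (simp add: T_def sum.cartesian_product)
  finally show ?thesis
    by (simp add: h_def sum_distrib_left sum_divide_distrib)
qed

text \<open>A sequence in \<open>strict_lists n (Suc K)\<close> has total excess k + 1 over 0, ...,
  n-1, hence entries at most n + k. Bounding \<open>J ! a + s\<close> by n + k + s leaves a sum that
  \<open>sum_vdm_lower\<close> evaluates to (k + 1) times the Vandermonde product.\<close>

lemma sdet_sum_ratio:
  assumes "K = (n choose 2) + k"
  shows "2 * (of_nat (n ^ 2) - of_nat K) * sdet_sum n s K \<le>
         of_nat (Suc k) * of_nat (n + k + s) * sdet_sum n s (Suc K)"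
proof -
  have "sdet J * (\<Sum>a<n. of_nat (J ! a) * of_nat (J ! a + s) *
         vdm n ((\<lambda>b. of_nat (J ! b))(a := of_nat (J ! a) - 1))) / (\<Prod>a<n. fact (J ! a + s))
      \<le> of_nat (Suc k) * of_nat (n + k + s) * (sdet J * schur_weight s J)"
    if J: "J \<in> strict_lists n (Suc K)" for J
  proof -
    let ?v = "\<lambda>a. vdm n ((\<lambda>b. of_nat (J ! b) :: rat)(a := of_nat (J ! a) - 1))"
    have J': "sorted_wrt (<) J" "length J = n" "sum_list J = Suc K"
      using J by (auto simp: strict_lists_def)
    have "(\<Sum>a<n. of_nat (J ! a) * of_nat (J ! a + s) * ?v a) \<le>
          (\<Sum>a<n. of_nat (n + k + s) * (of_nat (J ! a) * ?v a))"
    proof (rule sum_mono)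
      fix a assume a: "a \<in> {..<n}"
      show "of_nat (J ! a) * of_nat (J ! a + s) * ?v a \<le> of_nat (n + k + s) * (of_nat (J ! a) * ?v a)"
      proof (cases "J ! a = 0")
        case False
        \<comment> \<open>The bound on \<open>J ! a + s\<close> may only be multiplied by
          nonnegative terms. Lowering one entry of a strictly increasing integer sequence keeps it
          weakly increasing.\<close>
        have "?v a \<ge> 0"
        proof (rule vdm_nonneg)
          fix i j assume ij: "i < j" "j < n"
          then have "J ! i < J ! j"
            using J' by (simp add: sorted_wrt_iff_nth_less)
          then have "(of_nat (J ! i) :: rat) + 1 \<le> of_nat (J ! j)"
            by (metis Suc_leI of_nat_Suc of_nat_le_iff add.commute)
          then show "((\<lambda>b. of_nat (J ! b) :: rat)(a := of_nat (J ! a) - 1)) i \<le>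
              ((\<lambda>b. of_nat (J ! b))(a := of_nat (J ! a) - 1)) j"
            using ij by auto
        qed
        moreover have "J ! a + s \<le> n + k + s"
          using nth_strict_lists_le[of J n "Suc k" a] J a assms by simp
        then have "(of_nat (J ! a + s) :: rat) \<le> of_nat (n + k + s)"
          by (simp only: of_nat_le_iff)
        ultimately have "of_nat (J ! a + s) * (of_nat (J ! a) * ?v a) \<le> of_nat (n + k + s) * (of_nat (J ! a) * ?v a)"
          by (intro mult_right_mono) auto
        then show ?thesis by (simp only: mult_ac)
      qed simp
    qed
    also have "\<dots> = of_nat (n + k + s) * ((of_nat (sum_list J) - of_nat (n choose 2)) * vdm n (\<lambda>b. of_nat (J ! b)))"
    proof -
      have "(\<Sum>a<n. of_nat (J ! a)) = (of_nat (sum_list J) :: rat)"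
        by (simp add: sum_list_sum_nth atLeast0LessThan J'(2))
      moreover have "(\<Sum>b<n. of_nat b) = (of_nat (n choose 2) :: rat)"
        by (simp flip: sum_upto_choose)
      ultimately show ?thesis
        unfolding sum_distrib_left[symmetric] sum_vdm_lower by simp
    qed
    also have "\<dots> = of_nat (Suc k) * of_nat (n + k + s) * vdm n (\<lambda>b. of_nat (J ! b))"
      using J' assms by simp
    finally have "sdet J / (\<Prod>a<n. fact (J ! a + s)) * (\<Sum>a<n. of_nat (J ! a) * of_nat (J ! a + s) * ?v a) \<le>
        sdet J / (\<Prod>a<n. fact (J ! a + s)) * (of_nat (Suc k) * of_nat (n + k + s) * vdm n (\<lambda>b. of_nat (J ! b)))"
      using sdet_nonneg[OF J'(1)] by (intro mult_left_mono) (auto intro!: divide_nonneg_nonneg prod_nonneg)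
    then show ?thesis
      using J' by (simp add: schur_weight_def mult_ac)
  qed
  then show ?thesis
    unfolding raise_sdet_sum unfolding sdet_sum_def sum_distrib_left by (rule sum_mono)
qed

section \<open>From the coefficient \<open>smrc_coeff\<close> to the sums
  \<open>sdet_sum\<close>\<close>

lemma vdm_reverse: "vdm n (\<lambda>i. x (n - 1 - i)) = (- 1) ^ (n choose 2) * vdm n x"
proof -
  define P where "P = Sigma {..<n} (\<lambda>l. {..<l})"
  define rev where "rev = (\<lambda>(l, j). (n - 1 - j, n - 1 - l))"
  have vdm: "vdm n z = (\<Prod>(l, j)\<in>P. z l - z j)" for z :: "nat \<Rightarrow> 'a"
    by (simp add: vdm_def P_def prod.Sigma)
  have card: "card P = n choose 2"
    by (simp add: P_def sum_upto_choose)
  have "(\<Prod>(l, j)\<in>P. x (n - 1 - l) - x (n - 1 - j)) = (\<Prod>p\<in>P. - (case p of (l, j) \<Rightarrow> x l - x j))"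
    by (rule prod.reindex_bij_witness[where i = rev and j = rev]) (auto simp: P_def rev_def)
  also have "\<dots> = (- 1) ^ card P * (\<Prod>(l, j)\<in>P. x l - x j)"
    using prod.distrib[of "\<lambda>_. - 1" "\<lambda>(l, j). x l - x j" P] by (simp add: case_prod_unfold)
  finally show ?thesis
    unfolding vdm card .
qed

text \<open>The sign of the reversal is not counted directly: it is read off by reversing the rows
  of the nonzero Vandermonde determinant at 0, ..., n-1, where \<open>vdm_reverse\<close> gives the
  same sign. Transposition turns rows into columns.\<close>

lemma det_reverse_columns:
  fixes A :: "nat \<Rightarrow> nat \<Rightarrow> rat"
  shows "det (mat n n (\<lambda>(i, j). A i (n - 1 - j))) = (- 1) ^ (n choose 2) * det (mat n n (\<lambda>(i, j). A i j))"
proof -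
  define p where "p = (\<lambda>j. if j < n then n - 1 - j else j)"
  have p: "p permutes {0..<n}"
    by (rule bij_imp_permutes, rule bij_betw_byWitness[where f' = p]) (auto simp: p_def)
  have rows: "det (mat n n (\<lambda>(i, j). B (n - 1 - i) j)) = signof p * det (mat n n (\<lambda>(i, j). B i j))"
    for B :: "nat \<Rightarrow> nat \<Rightarrow> rat"
  proof -
    have "det (mat n n (\<lambda>(i, j). mat n n (\<lambda>(i, j). B i j) $$ (p i, j))) = signof p * det (mat n n (\<lambda>(i, j). B i j))"
      by (rule det_permute_rows[OF _ p]) simp
    moreover have "det (mat n n (\<lambda>(i, j). mat n n (\<lambda>(i, j). B i j) $$ (p i, j))) = det (mat n n (\<lambda>(i, j). B (n - 1 - i) j))"
      by (rule det_mat_cong) (auto simp: p_def)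
    ultimately show ?thesis by simp
  qed
  have "signof p * vdm n rat_of_nat = (- 1) ^ (n choose 2) * vdm n rat_of_nat"
    using rows[of "\<lambda>i j. \<Prod>k<j. rat_of_nat i - 0"] vdm_reverse[of n rat_of_nat]
    by (simp only: det_newton_basis)
  moreover have "vdm n rat_of_nat \<noteq> 0"
    by (auto simp: vdm_def)
  ultimately have sign: "signof p = ((- 1) ^ (n choose 2) :: rat)"
    by simp
  have transpose: "det (mat n n (\<lambda>(i, j). B i j)) = det (mat n n (\<lambda>(i, j). B j i))" for B :: "nat \<Rightarrow> nat \<Rightarrow> rat"
  proof -
    have "det (mat n n (\<lambda>(i, j). B i j)) = det (transpose_mat (mat n n (\<lambda>(i, j). B i j)))"
      by (rule det_transpose[symmetric, of _ n]) simp
    also have "transpose_mat (mat n n (\<lambda>(i, j). B i j)) = mat n n (\<lambda>(i, j). B j i)"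
      by (rule eq_matI) auto
    finally show ?thesis .
  qed
  show ?thesis
    using rows[of "\<lambda>i j. A j i"] transpose[of "\<lambda>i j. A i (n - 1 - j)"] transpose[of A]
    by (simp add: sign)
qed

text \<open>The upper arguments 2n-1, ..., 3, 1 run backwards compared with \<open>sdet\<close>. The
  sign of the reversal cancels against the part (-1)^(n choose 2) of the row signs, leaving (-1)^k;
  the scalings of rows and columns combine to 2^k / 2^(n choose 2).\<close>

lemma sym2_det_eq:
  assumes "length I = r + 1" "sum_list I = ((r + 1) choose 2) + k"
  shows "sym2_det r I = (- 1) ^ k * 2 ^ ((r + 1) choose 2) / 2 ^ k * sdet I"
proof -
  define n where "n = r + 1"
  define A where "A = (\<lambda>a b. of_nat ((2 * b + 1) choose (I ! a)) :: rat)"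
  have scale: "det (mat n n (\<lambda>(i, j). u i * v j * A i j)) = (\<Prod>i<n. u i) * (\<Prod>j<n. v j) * det (mat n n (\<lambda>(i, j). A i j))" 
    for u v :: "nat \<Rightarrow> rat"
  proof -
    have "(\<Prod>i = 0..<n. u i * v (p i) * A i (p i)) = (\<Prod>i<n. u i) * (\<Prod>j<n. v j) * (\<Prod>i = 0..<n. A i (p i))"
      if "p permutes {0..<n}" for p
      using prod.permute[OF that, of v] by (simp add: prod.distrib atLeast0LessThan o_def)
    then show ?thesis
      by (simp add: det_mat_permutes sum_distrib_left mult_ac)
  qed
  have pow: "(\<Prod>i<n. c ^ (I ! i)) = c ^ (n choose 2) * c ^ k" for c :: rat
    using assms by (simp add: n_def sum_list_sum_nth atLeast0LessThan power_add flip: power_sum)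
  have "sym2_det r I = det (mat n n (\<lambda>(i, j). (- 1) ^ (I ! i) * 1 * A i (n - 1 - j)))"
    unfolding sym2_det_def n_def by (rule det_mat_cong) (auto simp: A_def diff_mult_distrib2)
  also have "\<dots> = (- 1) ^ (n choose 2) * det (mat n n (\<lambda>(i, j). (- 1) ^ (I ! i) * 1 * A i j))"
    by (rule det_reverse_columns)
  also have "\<dots> = (- 1) ^ k * det (mat n n (\<lambda>(i, j). A i j))"
    unfolding scale pow by (simp flip: power_mult_distrib)
  finally have sym2: "sym2_det r I = (- 1) ^ k * det (mat n n (\<lambda>(i, j). A i j))" .
  have "(\<Prod>j<n. 1 / 4 ^ j) = (1 / 4 ^ (n choose 2) :: rat)"
    by (simp add: prod_dividef flip: power_sum sum_upto_choose)
  moreover have "sdet I = det (mat n n (\<lambda>(i, j). 2 ^ (I ! i) * (1 / 4 ^ j) * A i j))"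
    using assms by (simp add: sdet_def n_def A_def)
  ultimately have "sdet I = 2 ^ (n choose 2) * 2 ^ k / 4 ^ (n choose 2) * det (mat n n (\<lambda>(i, j). A i j))"
    unfolding scale pow by simp
  moreover have "(4 :: rat) ^ (n choose 2) = 2 ^ (n choose 2) * 2 ^ (n choose 2)"
    by (simp flip: power_mult_distrib)
  ultimately show ?thesis
    unfolding n_def[symmetric] by (simp add: sym2)
qed

text \<open>All powers of 2 depend on k only: the exponents 2N - |I| and (n choose 2) - k add up to
  2 (N - k).\<close>

lemma smrc_coeff_eq:
  assumes "smrc_codim g r d = int N"
  shows "smrc_coeff g r d =
    (\<Sum>k\<le>N. (- 4) ^ (N - k) / fact (N - k) * sdet_sum (r + 1) (r + g - d) (((r + 1) choose 2) + k))"
proof -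
  define n where "n = r + 1"
  define s where "s = r + g - d"
  have index: "smrc_index r (int N) = (\<Union>k\<in>{..N}. strict_lists n ((n choose 2) + k))"
  proof (intro equalityI subsetI)
    fix I assume I: "I \<in> smrc_index r (int N)"
    then have "I \<in> strict_lists n (sum_list I)"
      by (simp add: strict_lists_def smrc_index_def n_def)
    moreover from this have "n choose 2 \<le> sum_list I"
      by (rule strict_lists_choose_le)
    moreover have "sum_list I \<le> (n choose 2) + N"
      using I by (simp add: smrc_index_def n_def flip: of_nat_add)
    ultimately show "I \<in> (\<Union>k\<in>{..N}. strict_lists n ((n choose 2) + k))"
      by (intro UN_I[of "sum_list I - (n choose 2)"]) auto
  qed (auto simp: smrc_index_def strict_lists_def n_def)
  have "smrc_coeff g r d = (- 1) ^ N * (\<Sum>I\<in>smrc_index r (int N).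
        2 powi (2 * int N - int (sum_list I)) * sym2_det r I / fact (nat (int N - schur_deg I)) *
        ((\<Prod>l<n. \<Prod>j<l. of_nat (I ! l) - of_nat (I ! j)) / (\<Prod>j<n. fact (I ! j + s))))"
    by (simp add: smrc_coeff_def assms Let_def n_def s_def)
  also have "\<dots> = (- 1) ^ N * (\<Sum>k\<le>N. \<Sum>I\<in>strict_lists n ((n choose 2) + k).
        2 powi (2 * int N - int (sum_list I)) * sym2_det r I / fact (nat (int N - schur_deg I)) *
        ((\<Prod>l<n. \<Prod>j<l. of_nat (I ! l) - of_nat (I ! j)) / (\<Prod>j<n. fact (I ! j + s))))"
    unfolding index by (subst sum.UNION_disjoint) (auto simp: finite_strict_lists, auto simp: strict_lists_def)
  also have "\<dots> = (\<Sum>k\<le>N. (- 4) ^ (N - k) / fact (N - k) * sdet_sum n s ((n choose 2) + k))"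
    unfolding sum_distrib_left sdet_sum_def
  proof (intro sum.cong refl)
    fix k I assume k: "k \<in> {..N}" and I: "I \<in> strict_lists n ((n choose 2) + k)"
    have I': "length I = n" "sum_list I = (n choose 2) + k"
      using I by (auto simp: strict_lists_def)
    have nat: "nat (int N - schur_deg I) = N - k"
      using I' by (simp add: schur_deg_def)
    have "2 powi a * 2 powi b * 2 powi c = (2 :: rat) powi (a + b + c)" for a b c
      by (simp add: power_int_add)
    moreover have "2 * int N - int (sum_list I) + int (n choose 2) + - int k = 2 * int (N - k)"
      using k I' by (simp add: of_nat_diff)
    ultimately have "2 powi (2 * int N - int (sum_list I)) * 2 powi int (n choose 2) * 2 powi (- int k) =
        (2 :: rat) powi (2 * int (N - k))"
      by metis
    also have "\<dots> = 4 ^ (N - k)"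
      by (simp add: power_int_mult flip: power_mult_distrib)
    finally have two: "2 powi (2 * int N - int (sum_list I)) * 2 ^ (n choose 2) / 2 ^ k = (4 ^ (N - k) :: rat)"
      by (simp add: power_int_minus field_simps)
    have sign: "(- 1) ^ N * (- 1) ^ k * 4 ^ (N - k) = ((- 4) ^ (N - k) :: rat)"
    proof -
      have "(- 1) ^ N * (- 1) ^ k = ((- 1) ^ (N - k) :: rat)"
        using k by (simp add: minus_one_power_iff)
      then show ?thesis
        by (metis mult_minus1 power_mult_distrib)
    qed
    define Q where "Q = (\<Prod>l<n. \<Prod>j<l. rat_of_nat (I ! l) - rat_of_nat (I ! j)) / (\<Prod>j<n. fact (I ! j + s))"
    have "(- 1) ^ N * (2 powi (2 * int N - int (sum_list I)) * sym2_det r I / fact (nat (int N - schur_deg I)) * Q)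
       = ((- 1) ^ N * (- 1) ^ k * (2 powi (2 * int N - int (sum_list I)) * 2 ^ (n choose 2) / 2 ^ k)) / fact (N - k) * (sdet I * Q)"
      using sym2_det_eq[of I r k] I' by (simp add: nat n_def)
    also have "\<dots> = (- 4) ^ (N - k) / fact (N - k) * (sdet I * Q)"
      unfolding two sign ..
    finally show "(- 1) ^ N * (2 powi (2 * int N - int (sum_list I)) * sym2_det r I / fact (nat (int N - schur_deg I)) *
        ((\<Prod>l<n. \<Prod>j<l. rat_of_nat (I ! l) - rat_of_nat (I ! j)) / (\<Prod>j<n. fact (I ! j + s)))) =
       (- 4) ^ (N - k) / fact (N - k) * (sdet I * schur_weight s I)"
      using I' by (simp add: Q_def schur_weight_def vdm_def)
  qed
  finally show ?thesis
    by (simp add: n_def s_def)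
qed

section \<open>Positivity when the terms decrease\<close>

lemma alternating_sum_bounds:
  fixes f :: "nat \<Rightarrow> 'a :: linordered_idom"
  assumes "\<And>j. j < n \<Longrightarrow> f (Suc j) \<le> f j" and "\<And>j. j \<le> n \<Longrightarrow> 0 \<le> f j"
  shows "0 \<le> (\<Sum>j\<le>n. (- 1) ^ j * f j) \<and> (\<Sum>j\<le>n. (- 1) ^ j * f j) \<le> f 0"
  using assms
proof (induction n arbitrary: f)
  case (Suc n)
  have "(\<Sum>j\<le>Suc n. (- 1) ^ j * f j) = f 0 - (\<Sum>j\<le>n. (- 1) ^ j * f (Suc j))"
    by (simp add: sum.atMost_Suc_shift sum_negf del: sum.atMost_Suc)
  moreover have "0 \<le> (\<Sum>j\<le>n. (- 1) ^ j * f (Suc j)) \<and> (\<Sum>j\<le>n. (- 1) ^ j * f (Suc j)) \<le> f (Suc 0)"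
    by (rule Suc.IH) (use Suc.prems in auto)
  moreover have "f (Suc 0) \<le> f 0"
    by (rule Suc.prems) simp
  ultimately show ?case by linarith
qed simp

lemma alternating_sum_pos:
  fixes f :: "nat \<Rightarrow> 'a :: linordered_idom"
  assumes "\<And>j. j < n \<Longrightarrow> f (Suc j) < f j" and "\<And>j. j \<le> n \<Longrightarrow> 0 < f j"
  shows "0 < (\<Sum>j\<le>n. (- 1) ^ j * f j)"
proof (cases n)
  case (Suc m)
  have "(\<Sum>j\<le>Suc m. (- 1) ^ j * f j) = f 0 - (\<Sum>j\<le>m. (- 1) ^ j * f (Suc j))"
    by (simp add: sum.atMost_Suc_shift sum_negf del: sum.atMost_Suc)
  moreover have "(\<Sum>j\<le>m. (- 1) ^ j * f (Suc j)) \<le> f (Suc 0)"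
    using alternating_sum_bounds[of m "\<lambda>j. f (Suc j)"] assms Suc by (simp add: less_imp_le)
  moreover have "f (Suc 0) < f 0"
    by (rule assms) (simp add: Suc)
  ultimately show ?thesis
    using Suc by simp
qed (use assms(2)[of 0] in simp)

text \<open>Among the nonnegative branches of 0, 1, ..., n, the one that lowers every remaining
  entry by 1 leads to 0, ..., n-1. This starts the chain of ratio estimates, which only carries
  positivity from k to k + 1.\<close>

lemma sdet_upt_pos: "sdet [0..<n] > 0"
proof (induction n)
  case (Suc n)
  have upt: "[0..<Suc n] = 0 # map Suc [0..<n]"
    by (simp add: map_Suc_upt upt_conv_Cons del: upt_Suc)
  have "[0..<n] \<in> strip_preds (map Suc [0..<n])"
    by (auto simp: strip_preds_def)
  then have "sdet [0..<n] \<le> (\<Sum>J\<in>strip_preds (map Suc [0..<n]). sdet J)"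
    by (intro member_le_sum finite_strip_preds) (auto simp: strip_preds_def sdet_nonneg)
  moreover have "sdet [0..<Suc n] = (\<Sum>J\<in>strip_preds (map Suc [0..<n]). sdet J)"
    unfolding upt by (subst sdet_Cons) (auto simp: sorted_wrt_map)
  ultimately show ?case
    using Suc by simp
qed (simp add: sdet_Nil)

lemma schur_weight_pos: "sorted_wrt (<) I \<Longrightarrow> schur_weight s I > 0"
  unfolding schur_weight_def vdm_def
  by (intro divide_pos_pos prod_pos ballI) (auto simp: sorted_wrt_iff_nth_less)

lemma sdet_sum_0_pos: "sdet_sum n s (n choose 2) > 0"
proof -
  have "[0..<n] \<in> strict_lists n (n choose 2)"
    by (simp add: strict_lists_def sum_list_upt sum_upto_choose atLeast0LessThan interv_sum_list_conv_sum_set_nat)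
  then have "sdet [0..<n] * schur_weight s [0..<n] \<le> sdet_sum n s (n choose 2)"
    unfolding sdet_sum_def
    by (intro member_le_sum finite_strict_lists)
       (auto simp: strict_lists_def intro!: mult_nonneg_nonneg sdet_nonneg less_imp_le[OF schur_weight_pos])
  moreover have "sdet [0..<n] * schur_weight s [0..<n] > 0"
    by (intro mult_pos_pos sdet_upt_pos schur_weight_pos) simp
  ultimately show ?thesis by simp
qed

text \<open>If $n$ is large compared to $N$, then consecutive terms of the alternating sum
  $\sum_k (-4)^{N-k} a_k / (N-k)!$ decrease in absolute value, because $a_{k+1} > 4 a_k$.\<close>

lemma smrc_coeff_pos_if_large:
  assumes codim: "smrc_codim g r d = int N"
    and large: "4 * N * (r + N + (r + g - d)) < (r + 1) * (r + 2) + 2 - 2 * N"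
  shows "smrc_coeff g r d > 0"
proof -
  define n where "n = r + 1"
  define s where "s = r + g - d"
  define a where "a = (\<lambda>k. sdet_sum n s ((n choose 2) + k))"
  have sq: "2 * (n ^ 2 - (n choose 2)) = n * (n + 1)" "n choose 2 \<le> n ^ 2"
  proof -
    have "2 * (n choose 2) = n * (n - 1)"
      by (cases n) (simp_all add: choose_two)
    moreover have "n * (n - 1) + n = n ^ 2"
      by (cases n) (auto simp: power2_eq_square)
    ultimately show "2 * (n ^ 2 - (n choose 2)) = n * (n + 1)" "n choose 2 \<le> n ^ 2"
      by (auto simp: power2_eq_square algebra_simps)
  qed
  have step: "0 < a (Suc k) \<and> 4 * a k < a (Suc k)" if k: "k < N" and pos: "a k > 0" for k
  proof -
    have "4 * (Suc k * (n + k + s)) \<le> 4 * (N * (r + N + s))"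
      using k by (intro mult_le_mono) (auto simp: n_def)
    also have "\<dots> < (n + 1) * n + 2 - 2 * N"
      using large by (simp add: n_def s_def algebra_simps)
    \<comment> \<open>The constant 2 - 2N is the worst case of -2k, attained at k = N - 1.\<close>
    also have "\<dots> \<le> 2 * (n ^ 2 - (n choose 2)) - 2 * k"
      using k unfolding sq by simp
    finally have less: "4 * (Suc k * (n + k + s)) < 2 * (n ^ 2 - ((n choose 2) + k))"
      by simp
    \<comment> \<open>A truncated difference would be 0 and could not exceed anything, so the
      subtraction is exact and can be moved to the rationals.\<close>
    then have "n ^ 2 \<ge> (n choose 2) + k"
      by simp
    with less have "(4 * (of_nat (Suc k) * of_nat (n + k + s)) :: rat) < 2 * (of_nat (n ^ 2) - of_nat ((n choose 2) + k))"
      by (metis (no_types, lifting) of_nat_diff of_nat_less_iff of_nat_mult of_nat_numeral)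
    then have "4 * (of_nat (Suc k) * of_nat (n + k + s)) * a k < 2 * (of_nat (n ^ 2) - of_nat ((n choose 2) + k)) * a k"
      using pos by (intro mult_strict_right_mono)
    also have "\<dots> \<le> of_nat (Suc k) * of_nat (n + k + s) * a (Suc k)"
      unfolding a_def using sdet_sum_ratio[of "(n choose 2) + k" n k s] by simp
    finally have "of_nat (Suc k) * of_nat (n + k + s) * (4 * a k) < of_nat (Suc k) * of_nat (n + k + s) * a (Suc k)"
      by (simp only: mult_ac)
    then have "4 * a k < a (Suc k)"
      by (rule mult_left_less_imp_less) simp
    with pos show ?thesis by simp
  qed
  have pos: "a k > 0" if "k \<le> N" for k
    using that
  proof (induction k)
    case (Suc k)
    then show ?case using step[of k] by simp
  qed (simp add: a_def sdet_sum_0_pos)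
  define f where "f = (\<lambda>j. 4 ^ j / fact j * a (N - j))"
  have "smrc_coeff g r d = (\<Sum>k\<le>N. (- 4) ^ (N - k) / fact (N - k) * a k)"
    unfolding smrc_coeff_eq[OF codim] by (simp add: a_def n_def s_def)
  also have "\<dots> = (\<Sum>j\<le>N. (- 1) ^ j * f j)"
  proof (rule sum.reindex_bij_witness[where i = "\<lambda>j. N - j" and j = "\<lambda>k. N - k"])
    fix k assume "k \<in> {..N}"
    moreover have "(- 4 :: rat) ^ (N - k) = (- 1) ^ (N - k) * 4 ^ (N - k)"
      by (simp flip: power_mult_distrib)
    ultimately show "(- 1) ^ (N - k) * f (N - k) = (- 4) ^ (N - k) / fact (N - k) * a k"
      by (simp add: f_def)
  qed auto
  also have "\<dots> > 0"
  proof (rule alternating_sum_pos)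
    show "0 < f j" if "j \<le> N" for j
      using pos[of "N - j"] by (simp add: f_def)
    show "f (Suc j) < f j" if j: "j < N" for j
    proof -
      have "4 * a (N - Suc j) < a (N - j)"
        using step[of "N - Suc j"] pos[of "N - Suc j"] j by (simp add: Suc_diff_Suc)
      moreover have "a (N - j) \<le> of_nat (Suc j) * a (N - j)"
        using pos[of "N - j"] by simp
      ultimately have "4 * a (N - Suc j) < of_nat (Suc j) * a (N - j)"
        by simp
      then have "4 ^ j / fact (Suc j) * (4 * a (N - Suc j)) < 4 ^ j / fact (Suc j) * (of_nat (Suc j) * a (N - j))"
        by (intro mult_strict_left_mono) auto
      then show ?thesis
        by (simp add: f_def mult_ac del: of_nat_Suc)
    qed
  qed
  finally show ?thesis .
qed

section \<open>Sequences as partitions\<close>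

text \<open>The offset is needed because the branching rule removes the first entry: the rest of a
  staircase sequence starts at 1 and its predecessors start at 0 again.\<close>

fun stair_from :: "nat \<Rightarrow> nat list \<Rightarrow> nat list" where
  "stair_from a [] = []"
| "stair_from a (x # xs) = (a + x) # stair_from (Suc a) xs"

abbreviation stair :: "nat list \<Rightarrow> nat list" where
  "stair \<equiv> stair_from 0"

lemma length_stair_from [simp]: "length (stair_from a e) = length e"
  by (induction a e rule: stair_from.induct) auto

lemma nth_stair_from [simp]: "i < length e \<Longrightarrow> stair_from a e ! i = a + i + e ! i"
  by (induction a e arbitrary: i rule: stair_from.induct) (auto simp: nth_Cons split: nat.splits)

lemma stair_from_Suc: "stair_from (Suc a) e = map Suc (stair_from a e)"
  by (induction a e rule: stair_from.induct) auto

lemma stair_from_append: "stair_from a (e @ e') = stair_from a e @ stair_from (a + length e) e'"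
  by (induction a e rule: stair_from.induct) auto

lemma sorted_wrt_less_nth_Suc:
  "sorted_wrt (<) (I :: nat list) \<longleftrightarrow> (\<forall>i. Suc i < length I \<longrightarrow> I ! i < I ! Suc i)"
  by (rule sorted_wrt_iff_nth_Suc_transp) (auto intro: transpI)

lemma strict_stair_from [simp]: "sorted_wrt (<) (stair_from a e) \<longleftrightarrow> sorted e"
  unfolding sorted_wrt_less_nth_Suc sorted_iff_nth_Suc by auto

lemma sum_list_stair_from: "sum_list (stair_from a e) = sum_list e + a * length e + (length e choose 2)"
  by (induction a e rule: stair_from.induct) (auto simp: numeral_2_eq_2)

lemma strict_imp_stair:
  assumes "sorted_wrt (<) I"
  obtains e where "sorted e" "I = stair e"
proof
  define e where "e = map (\<lambda>i. I ! i - i) [0..<length I]"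
  show I: "I = stair e"
    by (rule nth_equalityI) (auto simp: e_def nth_strict_ge[OF assms])
  show "sorted e"
    using assms by (subst (asm) I) simp
qed

lemma inj_stair: "inj stair"
proof (rule injI)
  fix e e' assume *: "stair e = stair e'"
  then have "length e = length e'"
    by (metis length_stair_from)
  moreover have "e ! i = e' ! i" if "i < length e" for i
    using nth_stair_from[of i e 0] nth_stair_from[of i e' 0] that * calculation by simp
  ultimately show "e = e'"
    by (rule nth_equalityI)
qed

text \<open>Going from offset 1 to offset 0 absorbs one unit of each decrement. What is left is to
  keep a part or remove one box from it, which is a vertical strip.\<close>

lemma strip_preds_stair:
  "strip_preds (stair_from (Suc 0) e) = stair ` {e'. sorted e' \<and> list_all2 (\<lambda>x y. x = y \<or> x = Suc y) e e'}"
proof (intro equalityI subsetI)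
  fix J assume J: "J \<in> strip_preds (stair_from (Suc 0) e)"
  then obtain e' where e': "sorted e'" "J = stair e'"
    by (auto simp: strip_preds_def elim: strict_imp_stair)
  with J have "list_all2 (\<lambda>x y. x = y \<or> x = Suc y) e e'"
    by (fastforce simp: list_all2_conv_all_nth strip_preds_def)
  with e' show "J \<in> stair ` {e'. sorted e' \<and> list_all2 (\<lambda>x y. x = y \<or> x = Suc y) e e'}"
    by auto
qed (auto simp: strip_preds_def list_all2_conv_all_nth)

definition partitions_upto :: "nat \<Rightarrow> nat \<Rightarrow> nat list set" where
  "partitions_upto b k = {l. sorted_wrt (\<ge>) l \<and> (\<forall>x\<in>set l. 0 < x \<and> x \<le> b) \<and> sum_list l \<le> k}"

text \<open>A strictly increasing sequence $I$ of length $n$ is encoded by the partition with parts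
  $i_a - (a - 1)$: $I$ is \<open>stair (pad n l)\<close>.\<close>

definition pad :: "nat \<Rightarrow> nat list \<Rightarrow> nat list" where
  "pad n l = replicate (n - length l) 0 @ rev l"

lemma length_pad [simp]: "length l \<le> n \<Longrightarrow> length (pad n l) = n"
  by (simp add: pad_def)

lemma sum_list_pad [simp]: "sum_list (pad n l) = sum_list l"
  by (simp add: pad_def sum_list_replicate)

lemma sorted_pad [simp]: "sorted (pad n l) \<longleftrightarrow> sorted_wrt (\<ge>) l"
  by (auto simp: pad_def sorted_append sorted_wrt_rev sorted_replicate)

lemma pad_Cons: "length l \<le> n \<Longrightarrow> pad (Suc n) (x # l) = pad n l @ [x]"
  by (simp add: pad_def)

lemma pad_Nil: "pad (Suc n) [] = pad n [] @ [0]"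
  by (simp add: pad_def replicate_append_same)

lemma pad_Suc: "length l \<le> n \<Longrightarrow> pad (Suc n) l = 0 # pad n l"
  by (simp add: pad_def Suc_diff_le)

lemma inj_on_pad: "inj_on (pad n) {l. length l \<le> n \<and> 0 \<notin> set l}"
proof (rule inj_onI)
  have *: "dropWhile ((=) 0) (pad n l) = rev l" if "0 \<notin> set l" for l
  proof -
    have "dropWhile ((=) 0) (replicate m 0 @ rev l) = rev l" for m
    proof (induction m)
      case 0
      show ?case
        using that by (cases l rule: rev_cases) auto
    qed simp
    then show ?thesis by (simp add: pad_def)
  qed
  fix l l' assume l: "l \<in> {l. length l \<le> n \<and> 0 \<notin> set l}" "l' \<in> {l. length l \<le> n \<and> 0 \<notin> set l}" "pad n l = pad n l'"
  have "rev l = dropWhile ((=) 0) (pad n l)"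
    using l(1) by (simp add: *)
  also have "\<dots> = rev l'"
    unfolding l(3) using l(2) by (simp add: *)
  finally show "l = l'" by simp
qed

lemma sorted_eq_pad:
  assumes "sorted e" "length e = n"
  obtains l where "length l \<le> n" "0 \<notin> set l" "sorted_wrt (\<ge>) l" "e = pad n l"
proof -
  have "\<exists>l. length l \<le> length e \<and> 0 \<notin> set l \<and> sorted_wrt (\<ge>) l \<and> e = pad (length e) l"
    using assms(1)
  proof (induction e)
    case (Cons x e)
    show ?case
    proof (cases x)
      case 0
      obtain l where l: "length l \<le> length e" "0 \<notin> set l" "sorted_wrt (\<ge>) l" "e = pad (length e) l"
        using Cons by auto
      then have "x # e = pad (length (x # e)) l"
        using 0 pad_Suc[of l "length e"] by simp
      with l show ?thesis
        by (intro exI[of _ l]) simp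
    next
      case (Suc y)
      then show ?thesis
        using Cons.prems by (intro exI[of _ "rev (x # e)"]) (auto simp: pad_def sorted_wrt_append sorted_wrt_rev)
    qed
  qed (simp add: pad_def)
  then show thesis
    using that assms(2) by blast
qed

text \<open>The value 0 for partitions with too many parts allows every n to share the index set
  \<open>partitions_upto N N\<close>, and makes the recursion in n uniform.\<close>

definition sdet_part :: "nat \<Rightarrow> nat list \<Rightarrow> rat" where
  "sdet_part n l = (if length l \<le> n then sdet (stair (pad n l)) else 0)"

lemma strict_lists_eq_image:
  "strict_lists n ((n choose 2) + k) =
   (\<lambda>l. stair (pad n l)) ` {l. length l \<le> n \<and> 0 \<notin> set l \<and> sorted_wrt (\<ge>) l \<and> sum_list l = k}"
proof (intro equalityI subsetI)
  fix I assume I: "I \<in> strict_lists n ((n choose 2) + k)"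
  then obtain e where e: "sorted e" "I = stair e"
    by (auto simp: strict_lists_def elim: strict_imp_stair)
  with I have len: "length e = n" and sum: "sum_list e = k"
    by (auto simp: strict_lists_def sum_list_stair_from)
  obtain l where "length l \<le> n" "0 \<notin> set l" "sorted_wrt (\<ge>) l" "e = pad n l"
    using sorted_eq_pad[OF e(1) len] .
  with e(2) sum show "I \<in> (\<lambda>l. stair (pad n l)) ` {l. length l \<le> n \<and> 0 \<notin> set l \<and> sorted_wrt (\<ge>) l \<and> sum_list l = k}"
    by (intro image_eqI[of _ _ l]) auto
qed (auto simp: strict_lists_def sum_list_stair_from)

lemma length_partition_le:
  assumes "l \<in> partitions_upto b k"
  shows "length l \<le> k"
proof -
  have "length l \<le> sum_list l" if "\<forall>x\<in>set l. 0 < x" for l :: "nat list"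
    using that by (induction l) auto
  with assms show ?thesis
    by (fastforce simp: partitions_upto_def)
qed

lemma finite_partitions_upto: "finite (partitions_upto b k)"
proof (rule finite_subset)
  show "partitions_upto b k \<subseteq> {l. set l \<subseteq> {..b} \<and> length l \<le> k}"
    using length_partition_le by (auto simp: partitions_upto_def)
qed (rule finite_lists_length_le, simp)

lemma sdet_sum_eq_partitions:
  assumes "k \<le> N"
  shows "sdet_sum n s ((n choose 2) + k) =
    (\<Sum>l\<in>{l \<in> partitions_upto N N. sum_list l = k}. sdet_part n l * schur_weight s (stair (pad n l)))"
proof -
  let ?L = "{l. length l \<le> n \<and> 0 \<notin> set l \<and> sorted_wrt (\<ge>) l \<and> sum_list l = k}"
  have "sdet_sum n s ((n choose 2) + k) = (\<Sum>l\<in>?L. sdet (stair (pad n l)) * schur_weight s (stair (pad n l)))"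
    unfolding sdet_sum_def strict_lists_eq_image
  proof (subst sum.reindex)
    show "inj_on (\<lambda>l. stair (pad n l)) ?L"
      using inj_on_pad[of n] inj_stair by (auto simp: inj_on_def)
  qed simp
  also have "\<dots> = (\<Sum>l\<in>{l \<in> partitions_upto N N. sum_list l = k}. sdet_part n l * schur_weight s (stair (pad n l)))"
  proof (rule sum.mono_neutral_cong_left)
    show "finite {l \<in> partitions_upto N N. sum_list l = k}"
      by (simp add: finite_partitions_upto)
    show "?L \<subseteq> {l \<in> partitions_upto N N. sum_list l = k}"
      using assms by (auto simp: partitions_upto_def intro: order_trans[OF member_le_sum_list] intro!: Nat.gr0I)
    show "\<forall>l\<in>{l \<in> partitions_upto N N. sum_list l = k} - ?L. sdet_part n l * schur_weight s (stair (pad n l)) = 0"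
      by (auto simp: partitions_upto_def sdet_part_def)
  qed (auto simp: sdet_part_def)
  finally show ?thesis .
qed

text \<open>Puts a new largest part in front, or returns no list if the result would not be
  decreasing. A part 0 fits only in front of the empty partition, where it is dropped to keep the
  representation free of zeros.\<close>

fun extend :: "nat \<Rightarrow> nat list \<Rightarrow> nat list list" where
  "extend y [] = (if y = 0 then [[]] else [[y]])"
| "extend y (z # l) = (if z \<le> y then [y # z # l] else [])"

fun extend_strip :: "nat \<Rightarrow> nat list \<Rightarrow> nat list list" where
  "extend_strip 0 l = extend 0 l"
| "extend_strip (Suc y) l = extend (Suc y) l @ extend y l"

fun strips :: "nat list \<Rightarrow> nat list list" where
  "strips [] = [[]]"
| "strips (x # l) = concat (map (extend_strip x) (strips l))"

lemma extend_image:
  assumes "length l \<le> n" "sorted_wrt (\<ge>) l" "0 \<notin> set l"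
  shows "pad (Suc n) ` set (extend y l) = {e. sorted e \<and> e = pad n l @ [y]}"
proof (cases l)
  case Nil
  then show ?thesis
    by (auto simp: pad_def sorted_append sorted_replicate replicate_append_same)
next
  case (Cons z l')
  moreover have "\<forall>x\<in>set l'. x \<le> y" if "z \<le> y"
    using that assms Cons by fastforce
  ultimately show ?thesis
    using assms by (auto simp: pad_def sorted_append sorted_replicate sorted_wrt_rev)
qed

lemma extend_props:
  assumes "l' \<in> set (extend y l)" "sorted_wrt (\<ge>) l" "0 \<notin> set l"
  shows "sorted_wrt (\<ge>) l' \<and> 0 \<notin> set l' \<and> length l' \<le> Suc (length l)"
  using assms by (cases l) (auto split: if_splits intro: order_trans)

lemma set_extend_strip:
  "set (extend_strip x l) = (\<Union>y\<in>{y. x = y \<or> x = Suc y}. set (extend y l))"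
  by (cases x) auto

lemma strips_props:
  assumes "m \<in> set (strips l)"
  shows "sorted_wrt (\<ge>) m \<and> 0 \<notin> set m \<and> length m \<le> length l"
  using assms
proof (induction l arbitrary: m)
  case (Cons x l)
  then obtain m' y where m': "m' \<in> set (strips l)" "m \<in> set (extend y m')"
    by (auto simp: set_extend_strip)
  show ?case
    using Cons.IH[OF m'(1)] extend_props[OF m'(2)] by auto
qed simp

lemma strips_image:
  assumes "length l \<le> n"
  shows "pad n ` set (strips l) = {e'. sorted e' \<and> list_all2 (\<lambda>x y. x = y \<or> x = Suc y) (pad n l) e'}"
  using assms
proof (induction l arbitrary: n)
  case Nil
  have "list_all2 (\<lambda>x y. x = y \<or> x = Suc y) (replicate n 0) e' \<longleftrightarrow> e' = replicate n 0" for e' :: "nat list"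
    by (induction n arbitrary: e') (auto simp: list_all2_Cons1)
  then have "{e'. sorted e' \<and> list_all2 (\<lambda>x y. x = y \<or> x = Suc y) (pad n []) e'} = {e'. sorted e' \<and> e' = replicate n 0}"
    by (simp add: pad_def)
  also have "\<dots> = {pad n []}"
    by (auto simp: pad_def)
  finally show ?case
    by simp
next
  case (Cons x l)
  then obtain n' where n: "n = Suc n'" "length l \<le> n'"
    by (cases n) auto
  have "pad n ` set (strips (x # l)) =
      (\<Union>m\<in>set (strips l). \<Union>y\<in>{y. x = y \<or> x = Suc y}. pad n ` set (extend y m))"
    by (auto simp: set_extend_strip)
  also have "\<dots> = (\<Union>m\<in>set (strips l). \<Union>y\<in>{y. x = y \<or> x = Suc y}. {e. sorted e \<and> e = pad n' m @ [y]})"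
    unfolding n(1) using n(2) strips_props[of _ l]
    by (intro SUP_cong refl extend_image) fastforce+
  also have "\<dots> = {e @ [y] | e y. e \<in> pad n' ` set (strips l) \<and> (x = y \<or> x = Suc y) \<and> sorted (e @ [y])}"
    by auto
  also have "\<dots> = {e'. sorted e' \<and> list_all2 (\<lambda>x y. x = y \<or> x = Suc y) (pad n' l @ [x]) e'}"
  proof (intro equalityI subsetI)
    fix e' assume "e' \<in> {e'. sorted e' \<and> list_all2 (\<lambda>x y. x = y \<or> x = Suc y) (pad n' l @ [x]) e'}"
    then obtain e y where "e' = e @ [y]" "list_all2 (\<lambda>x y. x = y \<or> x = Suc y) (pad n' l) e" "x = y \<or> x = Suc y"
        "sorted (e @ [y])"
      by (auto simp: list_all2_append1 list_all2_Cons1)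
    moreover from this have "e \<in> pad n' ` set (strips l)"
      unfolding Cons.IH[OF n(2)] by (simp add: sorted_append)
    ultimately show "e' \<in> {e @ [y] | e y. e \<in> pad n' ` set (strips l) \<and> (x = y \<or> x = Suc y) \<and> sorted (e @ [y])}"
      by blast
  next
    fix e' assume "e' \<in> {e @ [y] | e y. e \<in> pad n' ` set (strips l) \<and> (x = y \<or> x = Suc y) \<and> sorted (e @ [y])}"
    then obtain e y where "e' = e @ [y]" "e \<in> pad n' ` set (strips l)" "x = y \<or> x = Suc y" "sorted (e @ [y])"
      by blast
    then show "e' \<in> {e'. sorted e' \<and> list_all2 (\<lambda>x y. x = y \<or> x = Suc y) (pad n' l @ [x]) e'}"
      unfolding Cons.IH[OF n(2)] by (auto intro!: list_all2_appendI)
  qed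
  finally show ?case
    using n by (simp add: pad_Cons)
qed

text \<open>Needed to sum over the list instead of the set. A result determines the tail it was
  built from: the tail follows its first part, and an empty result can only come from an empty
  tail.\<close>

lemma distinct_strips: "0 \<notin> set l \<Longrightarrow> distinct (strips l)"
proof (induction l)
  case (Cons x l)
  then obtain y where x: "x = Suc y"
    by (cases x) auto
  have mem: "l' = x # m \<or> l' = y # m \<or> (l' = [] \<and> m = [])" if "l' \<in> set (extend_strip x m)" for l' m
    using that by (cases m) (auto simp: x split: if_splits)
  have "distinct (extend_strip x m)" for m
    by (cases m) (auto simp: x)
  moreover have "m = m'" if "l' \<in> set (extend_strip x m)" "l' \<in> set (extend_strip x m')" for l' m m'
    using mem[OF that(1)] mem[OF that(2)] by auto
  ultimately have "distinct ms \<Longrightarrow> distinct (concat (map (extend_strip x) ms))" for ms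
    by (induction ms) (simp_all, blast)
  with Cons show ?case by simp
qed simp

lemma sum_strip_preds_pad:
  assumes "length l \<le> n" "0 \<notin> set l"
  shows "(\<Sum>J\<in>strip_preds (stair_from (Suc 0) (pad n l)). sdet J) = sum_list (map (sdet_part n) (strips l))"
proof -
  have "(\<Sum>J\<in>strip_preds (stair_from (Suc 0) (pad n l)). sdet J) = (\<Sum>J\<in>(\<lambda>m. stair (pad n m)) ` set (strips l). sdet J)"
    unfolding strip_preds_stair strips_image[OF assms(1), symmetric] by (simp add: image_image)
  also have "\<dots> = (\<Sum>m\<in>set (strips l). sdet (stair (pad n m)))"
  proof (subst sum.reindex)
    have "set (strips l) \<subseteq> {l. length l \<le> n \<and> 0 \<notin> set l}"
      using strips_props[of _ l] assms(1) by fastforce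
    then have "inj_on (pad n) (set (strips l))"
      by (rule inj_on_subset[OF inj_on_pad])
    then show "inj_on (\<lambda>m. stair (pad n m)) (set (strips l))"
      using inj_stair by (auto simp: inj_on_def)
  qed simp
  also have "\<dots> = (\<Sum>m\<in>set (strips l). sdet_part n m)"
    using strips_props[of _ l] assms(1) by (intro sum.cong) (fastforce simp: sdet_part_def)+
  also have "\<dots> = sum_list (map (sdet_part n) (strips l))"
    using distinct_strips[OF assms(2)] by (simp add: sum_list_distinct_conv_sum_set)
  finally show ?thesis .
qed

lemma sdet_part_0: "sdet_part 0 l = (if l = [] then 1 else 0)"
  by (simp add: sdet_part_def pad_def sdet_Nil)

text \<open>The first entry of the sequence is 0 if a row is free and otherwise the smallest part,
  \<open>last l\<close>. The leading factor of \<open>sdet_Cons\<close> is then 1, or 2 for a part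
  1, or 0 for anything larger.\<close>

lemma sdet_part_Suc:
  assumes "sorted_wrt (\<ge>) l" "0 \<notin> set l"
  shows "sdet_part (Suc n) l =
    (if length l \<le> n then sum_list (map (sdet_part n) (strips l))
     else if length l = Suc n \<and> last l = 1 then 2 * sum_list (map (sdet_part n) (strips (butlast l)))
     else 0)"
proof -
  consider "length l \<le> n" | "length l = Suc n" | "length l > Suc n"
    by linarith
  then show ?thesis
  proof cases
    case 1
    then have "sdet_part (Suc n) l = sdet (0 # stair_from (Suc 0) (pad n l))"
      by (simp add: sdet_part_def pad_Suc)
    also have "\<dots> = (\<Sum>J\<in>strip_preds (stair_from (Suc 0) (pad n l)). sdet J)"
      using assms by (subst sdet_Cons) (auto simp: stair_from_Suc[of 0] sorted_wrt_map)
    finally show ?thesis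
      using 1 assms by (simp add: sum_strip_preds_pad)
  next
    case 2
    then obtain l' x where l: "l = l' @ [x]"
      by (metis append_butlast_last_id length_0_conv nat.distinct(1))
    with 2 have len: "length l' = n" by simp
    have pad: "pad (Suc n) l = x # pad n l'"
      using len by (simp add: pad_def l)
    have "sorted (pad (Suc n) l)"
      using assms by simp
    then have "sorted_wrt (<) (stair (x # pad n l'))"
      unfolding pad strict_stair_from .
    then have "sdet (stair (x # pad n l')) =
        (if x = 0 then 1 else if x = 1 then 2 else 0) * (\<Sum>J\<in>strip_preds (stair_from (Suc 0) (pad n l')). sdet J)"
      by (simp only: stair_from.simps add_0 sdet_Cons)
    moreover have "x \<noteq> 0" "0 \<notin> set l'"
      using assms by (auto simp: l)
    ultimately show ?thesis
      using 2 len by (simp add: sdet_part_def pad sum_strip_preds_pad) (simp add: l)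
  qed (simp add: sdet_part_def)
qed

section \<open>Sums over partitions\<close>

lemma partitions_upto_rec:
  "partitions_upto b k = insert [] (\<Union>x\<in>{1..min b k}. (#) x ` partitions_upto x (k - x))"
proof (intro equalityI subsetI)
  fix l assume "l \<in> partitions_upto b k"
  then have "a \<in> {1..min b k} \<and> l' \<in> partitions_upto a (k - a)" if "l = a # l'" for a l'
    using that by (auto simp: partitions_upto_def)
  then show "l \<in> insert [] (\<Union>x\<in>{1..min b k}. (#) x ` partitions_upto x (k - x))"
    by (cases l) blast+
next
  fix l assume "l \<in> insert [] (\<Union>x\<in>{1..min b k}. (#) x ` partitions_upto x (k - x))"
  then show "l \<in> partitions_upto b k"
    by (fastforce simp: partitions_upto_def)
qed

lemma sum_partitions_upto_rec:
  "(\<Sum>l\<in>partitions_upto b k. f l) = f [] + (\<Sum>x=1..min b k. \<Sum>l\<in>partitions_upto x (k - x). f (x # l))"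
proof -
  have "(\<Sum>l\<in>partitions_upto b k. f l) = f [] + (\<Sum>l\<in>(\<Union>x\<in>{1..min b k}. (#) x ` partitions_upto x (k - x)). f l)"
    unfolding partitions_upto_rec[of b k] by (subst sum.insert) (auto simp: finite_partitions_upto)
  also have "(\<Sum>l\<in>(\<Union>x\<in>{1..min b k}. (#) x ` partitions_upto x (k - x)). f l) =
      (\<Sum>x=1..min b k. \<Sum>l\<in>(#) x ` partitions_upto x (k - x). f l)"
    by (rule sum.UNION_disjoint) (auto simp: finite_partitions_upto)
  finally show ?thesis
    by (simp add: sum.reindex)
qed

text \<open>The first i + 1 parts are all at least \<open>l ! i\<close>. This fixes how long the
  precomputed row for part i has to be: \<open>N div Suc i\<close>.\<close>

lemma nth_partition_le:
  assumes "l \<in> partitions_upto b k" "i < length l"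
  shows "l ! i \<le> k div Suc i"
proof -
  have "Suc i * l ! i = (\<Sum>j\<le>i. l ! i)"
    by simp
  also have "\<dots> \<le> (\<Sum>j\<le>i. l ! j)"
    using assms by (intro sum_mono) (auto simp: partitions_upto_def sorted_wrt_iff_nth_less le_less)
  also have "\<dots> \<le> (\<Sum>j<length l. l ! j)"
    using assms by (intro sum_mono2) auto
  also have "\<dots> \<le> k"
    using assms by (simp add: partitions_upto_def sum_list_sum_nth atLeast0LessThan)
  finally show ?thesis
    unfolding less_eq_div_iff_mult_less_eq[OF zero_less_Suc] by (simp only: mult.commute)
qed

text \<open>Families indexed by partitions are stored in tries, so that a sum over partitions of products over
  the parts can be evaluated by factoring out one part at a time. The functions used
  in the computation are first-order on purpose: the simplifier evaluates under abstractions,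
  and recursive functions in the body of an abstraction would be unfolded without end.\<close>

datatype 'a trie = Node 'a "'a trie list"

fun lookup :: "'a trie \<Rightarrow> nat list \<Rightarrow> 'a" where
  "lookup (Node v ts) [] = v"
| "lookup (Node v ts) (x # l) = lookup (ts ! (x - 1)) l"

text \<open>The argument h is fuel for structural recursion; h >= k is enough because each part uses
  up at least 1 of k. A node stores the partition that leads to it, and the child for a next part x
  sits at position x - 1.\<close>

fun partition_trie :: "nat \<Rightarrow> nat list \<Rightarrow> nat \<Rightarrow> nat \<Rightarrow> nat list trie"
  and partition_tries :: "nat \<Rightarrow> nat list \<Rightarrow> nat \<Rightarrow> nat \<Rightarrow> nat list trie list" where
  "partition_trie 0 l b k = Node l []"
| "partition_trie (Suc h) l b k = Node l (partition_tries h l b k)"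
| "partition_tries h l 0 k = []"
| "partition_tries h l (Suc b) k = partition_tries h l b k @
     (if Suc b \<le> k then [partition_trie h (l @ [Suc b]) (Suc b) (k - Suc b)] else [])"

lemma partition_tries_eq:
  "partition_tries h l b k = map (\<lambda>x. partition_trie h (l @ [x]) x (k - x)) [1..<Suc (min b k)]"
proof (induction b)
  case (Suc b)
  show ?case
  proof (cases "Suc b \<le> k")
    case True
    then have "min b k = b" "min (Suc b) k = Suc b"
      by auto
    with True Suc show ?thesis by simp
  next
    case False
    then have "min b k = k" "min (Suc b) k = k"
      by auto
    with False Suc show ?thesis by simp
  qed
qed simp

lemma partition_trie_eq:
  assumes "k \<le> h"
  shows "partition_trie h l b k = Node l (map (\<lambda>x. partition_trie (h - 1) (l @ [x]) x (k - x)) [1..<Suc (min b k)])"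
  using assms by (cases h) (auto simp: partition_tries_eq)

lemma set_partition_trie:
  "k \<le> h \<Longrightarrow> set_trie (partition_trie h l b k) = (@) l ` partitions_upto b k"
proof (induction h arbitrary: l b k)
  case 0
  moreover have "partitions_upto b 0 = {[]}"
    by (subst partitions_upto_rec) simp
  ultimately show ?case by simp
next
  case (Suc h)
  have "set_trie (partition_trie (Suc h) l b k) =
      insert l (\<Union>x\<in>{1..min b k}. set_trie (partition_trie h (l @ [x]) x (k - x)))"
    by (auto simp: partition_tries_eq less_Suc_eq_le simp del: upt_Suc)
  also have "(\<Union>x\<in>{1..min b k}. set_trie (partition_trie h (l @ [x]) x (k - x))) =
      (\<Union>x\<in>{1..min b k}. (@) (l @ [x]) ` partitions_upto x (k - x))"
    using Suc.prems by (intro SUP_cong refl Suc.IH) auto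
  also have "insert l \<dots> = (@) l ` partitions_upto b k"
    unfolding partitions_upto_rec[of b k] by (simp add: image_UN image_image)
  finally show ?case .
qed

lemma lookup_partition_trie:
  "m \<in> partitions_upto b k \<Longrightarrow> k \<le> h \<Longrightarrow> lookup (map_trie f (partition_trie h l b k)) m = f (l @ m)"
proof (induction m arbitrary: h l b k)
  case (Cons x m)
  then have x: "x \<in> {1..min b k}" "m \<in> partitions_upto x (k - x)"
    unfolding partitions_upto_rec[of b k] by auto
  moreover from x have "[1..<Suc (min b k)] ! (x - 1) = x" "x - 1 < length [1..<Suc (min b k)]"
    by (auto simp: nth_upt simp del: upt_Suc)
  ultimately have "lookup (map_trie f (partition_trie h l b k)) (x # m) =
      lookup (map_trie f (partition_trie (h - 1) (l @ [x]) x (k - x))) m"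
    unfolding partition_trie_eq[OF Cons.prems(2)] by (simp add: nth_map del: upt_Suc length_upt)
  also have "\<dots> = f ((l @ [x]) @ m)"
    using x Cons.prems(2) by (intro Cons.IH) auto
  finally show ?case by simp
next
  case Nil
  then show ?case by (cases h) auto
qed

text \<open>Up to a factor that does not depend on $x$, entry $x$ of \<open>content_row m (m + s) c\<close> is
  $(m+x)!/(m+x+s)!$; this clears the denominators of the weights.\<close>

fun content_row_step :: "int \<Rightarrow> int \<Rightarrow> int list \<Rightarrow> int list" where
  "content_row_step m t [] = []"
| "content_row_step m t (x # xs) = t * x # map ((*) m) (x # xs)"

text \<open>In closed form, entry x is (m+1)...(m+x) (t+x+1)...(t+c); the recursion obtains it by
  products only.\<close>

fun content_row :: "int \<Rightarrow> int \<Rightarrow> nat \<Rightarrow> int list" where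
  "content_row m t 0 = [1]"
| "content_row m t (Suc c) = content_row_step (m + 1) (t + 1) (content_row (m + 1) (t + 1) c)"

text \<open>In each pair, the first component is the product of the entries 0 of this and all later
  rows, the weight of having no further part; the second holds the entries for parts 1, 2, and so
  on.\<close>

fun add_content_row :: "int list \<Rightarrow> (int \<times> int list) list \<Rightarrow> (int \<times> int list) list" where
  "add_content_row [] rs = rs"
| "add_content_row (x # xs) [] = [(x, xs)]"
| "add_content_row (x # xs) ((z, cs) # rs) = (x * z, xs) # (z, cs) # rs"

fun content_rows :: "int \<Rightarrow> int \<Rightarrow> nat list \<Rightarrow> (int \<times> int list) list" where
  "content_rows m t [] = []"
| "content_rows m t (c # cs) = add_content_row (content_row m t c) (content_rows (m - 1) (t - 1) cs)"

fun trie_sum :: "(int \<times> int list) list \<Rightarrow> int trie \<Rightarrow> int"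
  and tries_sum :: "(int \<times> int list) list \<Rightarrow> int list \<Rightarrow> int trie list \<Rightarrow> int" where
  "trie_sum [] (Node v ts) = v"
| "trie_sum ((z, cs) # rs) (Node v ts) = v * z + tries_sum rs cs ts"
| "tries_sum rs (c # cs) (t # ts) = c * trie_sum rs t + tries_sum rs cs ts"
| "tries_sum rs [] ts = 0"
| "tries_sum rs (c # cs) [] = 0"

fun content_weight :: "int \<Rightarrow> int \<Rightarrow> nat list \<Rightarrow> nat list \<Rightarrow> int" where
  "content_weight m t [] l = 1"
| "content_weight m t (c # cs) [] = content_row m t c ! 0 * content_weight (m - 1) (t - 1) cs []"
| "content_weight m t (c # cs) (x # l) = content_row m t c ! x * content_weight (m - 1) (t - 1) cs l"

lemma length_content_row [simp]: "length (content_row m t c) = Suc c"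
proof (induction m t c rule: content_row.induct)
  case (2 m t c)
  then show ?case
    by (cases "content_row (m + 1) (t + 1) c") auto
qed simp

lemma content_rows_Cons:
  "content_rows m t (c # cs) = (content_weight m t (c # cs) [], tl (content_row m t c)) # content_rows (m - 1) (t - 1) cs"
proof (induction cs arbitrary: m t c)
  case Nil
  show ?case
    using length_content_row[of m t c] by (cases "content_row m t c") auto
next
  case (Cons d cs)
  show ?case
    using length_content_row[of m t c] Cons.IH[of "m - 1" "t - 1" d]
    by (cases "content_row m t c") auto
qed

lemma tries_sum_eq:
  "length ts \<le> length cs \<Longrightarrow> tries_sum rs cs ts = (\<Sum>i<length ts. cs ! i * trie_sum rs (ts ! i))"
proof (induction ts arbitrary: cs)
  case Nil
  then show ?case by (cases cs) auto
next
  case (Cons t ts)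
  then obtain c cs' where cs: "cs = c # cs'" by (cases cs) auto
  show ?case
    using Cons by (simp add: cs sum.lessThan_Suc_shift del: sum.lessThan_Suc)
qed

lemma trie_sum_partition_trie:
  assumes "k \<le> h" "k \<le> length cs" "\<And>i. i < length cs \<Longrightarrow> min b (k div Suc i) \<le> cs ! i"
  shows "trie_sum (content_rows m t cs) (map_trie f (partition_trie h l b k)) =
         (\<Sum>p\<in>partitions_upto b k. f (l @ p) * content_weight m t cs p)"
  using assms
proof (induction cs arbitrary: m t b k h l)
  case Nil
  moreover have "partitions_upto b 0 = {[]}"
    by (subst partitions_upto_rec) simp
  moreover have "partition_trie h l b 0 = Node l []"
    by (subst partition_trie_eq) simp_all
  ultimately show ?case
    by simp
next
  case (Cons c cs)
  have IH: "trie_sum (content_rows (m - 1) (t - 1) cs) (map_trie f (partition_trie (h - 1) (l @ [x]) x (k - x))) =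
      (\<Sum>p\<in>partitions_upto x (k - x). f (l @ x # p) * content_weight (m - 1) (t - 1) cs p)"
    if x: "x \<in> {1..min b k}" for x
  proof -
    have "min x ((k - x) div Suc i) \<le> cs ! i" if "i < length cs" for i
    proof -
      define y where "y = min x ((k - x) div Suc i)"
      have "y * Suc i \<le> k - x"
        unfolding less_eq_div_iff_mult_less_eq[OF zero_less_Suc, symmetric] by (simp add: y_def)
      moreover have "y \<le> x"
        by (simp add: y_def)
      ultimately have "y * Suc (Suc i) \<le> k"
        using x by simp
      \<comment> \<open>After a first part x, a value y that is to occur i + 1 more times satisfies
        y <= x and (i+1) y <= k - x, hence (i+2) y <= k. So the row bounds are inherited with the
        index shifted by one.\<close>
      then have "y \<le> k div Suc (Suc i)"
        unfolding less_eq_div_iff_mult_less_eq[OF zero_less_Suc] .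
      with \<open>y \<le> x\<close> x have "y \<le> min b (k div Suc (Suc i))"
        by simp
      also have "\<dots> \<le> cs ! i"
        using Cons.prems(3)[of "Suc i"] that by simp
      finally show ?thesis
        by (simp add: y_def)
    qed
    then have "trie_sum (content_rows (m - 1) (t - 1) cs) (map_trie f (partition_trie (h - 1) (l @ [x]) x (k - x))) =
      (\<Sum>p\<in>partitions_upto x (k - x). f ((l @ [x]) @ p) * content_weight (m - 1) (t - 1) cs p)"
      using x Cons.prems(1,2) by (intro Cons.IH) auto
    then show ?thesis by simp
  qed
  have "min b k \<le> c"
    using Cons.prems(3)[of 0] by simp
  then have "trie_sum (content_rows m t (c # cs)) (map_trie f (partition_trie h l b k)) =
      f l * content_weight m t (c # cs) [] +
      (\<Sum>i<min b k. tl (content_row m t c) ! i *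
        trie_sum (content_rows (m - 1) (t - 1) cs) (map_trie f (partition_trie (h - 1) (l @ [Suc i]) (Suc i) (k - Suc i))))"
    unfolding content_rows_Cons partition_trie_eq[OF Cons.prems(1)]
    by (simp add: tries_sum_eq del: upt_Suc content_weight.simps)
  also have "(\<Sum>i<min b k. tl (content_row m t c) ! i *
        trie_sum (content_rows (m - 1) (t - 1) cs) (map_trie f (partition_trie (h - 1) (l @ [Suc i]) (Suc i) (k - Suc i)))) =
      (\<Sum>x=1..min b k. content_row m t c ! x *
        trie_sum (content_rows (m - 1) (t - 1) cs) (map_trie f (partition_trie (h - 1) (l @ [x]) x (k - x))))"
    using \<open>min b k \<le> c\<close>
    by (intro sum.reindex_bij_witness[where j = Suc and i = "\<lambda>x. x - 1"]) (auto simp: nth_tl)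
  also have "\<dots> = (\<Sum>x=1..min b k. \<Sum>p\<in>partitions_upto x (k - x). f (l @ x # p) * content_weight m t (c # cs) (x # p))"
  proof (intro sum.cong refl)
    fix x assume "x \<in> {1..min b k}"
    from IH[OF this] show "content_row m t c ! x *
        trie_sum (content_rows (m - 1) (t - 1) cs) (map_trie f (partition_trie (h - 1) (l @ [x]) x (k - x))) =
        (\<Sum>p\<in>partitions_upto x (k - x). f (l @ x # p) * content_weight m t (c # cs) (x # p))"
      by (simp add: sum_distrib_left mult_ac)
  qed
  finally show ?case
    by (subst sum_partitions_upto_rec) (simp del: content_weight.simps)
qed

lemma nth_content_row:
  "x \<le> c \<Longrightarrow> rat_of_int (content_row (int p) (int (p + s)) c ! x) =
     fact (p + x) / fact p * (fact (p + s + c) / fact (p + s + x))"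
proof (induction c arbitrary: p x)
  case (Suc c)
  obtain y ys where r: "content_row (int p + 1) (int (p + s) + 1) c = y # ys"
    by (metis length_content_row length_Suc_conv)
  have IH: "rat_of_int ((y # ys) ! z) =
      fact (p + Suc z) / fact (Suc p) * (fact (p + s + Suc c) / fact (p + s + Suc z))" if "z \<le> c" for z
    using Suc.IH[OF that, of "Suc p"] r by (simp add: add_ac del: fact_Suc)
  have f: "fact (Suc p) = of_nat (Suc p) * (fact p :: rat)" "fact (Suc (p + s)) = of_nat (Suc (p + s)) * (fact (p + s) :: rat)"
    by (rule fact_Suc)+
  show ?case
  proof (cases x)
    case 0
    have cancel: "a * (b / (a * d)) = b / d" if "a \<noteq> 0" for a b d :: rat
      using that by simp
    have "rat_of_int (content_row (int p) (int (p + s)) (Suc c) ! x) = of_nat (Suc (p + s)) * rat_of_int ((y # ys) ! 0)"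
      using r by (simp add: 0)
    also have "\<dots> = of_nat (Suc (p + s)) * (fact (p + s + Suc c) / (of_nat (Suc (p + s)) * fact (p + s)))"
      using IH[of 0] f(2) by (simp del: fact_Suc of_nat_Suc)
    also have "\<dots> = fact (p + s + Suc c) / fact (p + s)"
      by (rule cancel) (simp del: of_nat_Suc)
    finally show ?thesis
      by (simp add: 0 del: fact_Suc)
  next
    case (Suc z)
    have cancel: "a * (b / (a * d) * e) = b / d * e" if "a \<noteq> 0" for a b d e :: rat
      using that by simp
    have "length (y # ys) = Suc c"
      using length_content_row r by metis
    then have "content_row (int p) (int (p + s)) (Suc c) ! x = (int p + 1) * (y # ys) ! z"
      using r Suc Suc.prems by (simp add: nth_map del: nth_Cons_Suc list.map)
    then have "rat_of_int (content_row (int p) (int (p + s)) (Suc c) ! x) = of_nat (Suc p) * rat_of_int ((y # ys) ! z)"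
      by simp
    also have "\<dots> = of_nat (Suc p) * (fact (p + Suc z) / (of_nat (Suc p) * fact p) * (fact (p + s + Suc c) / fact (p + s + Suc z)))"
      using IH[of z] f(1) Suc Suc.prems by (simp del: fact_Suc of_nat_Suc)
    also have "\<dots> = fact (p + Suc z) / fact p * (fact (p + s + Suc c) / fact (p + s + Suc z))"
      by (rule cancel) (simp del: of_nat_Suc)
    finally show ?thesis
      using Suc by simp
  qed
qed simp

section \<open>Splitting the weights into a table and a product over the parts\<close>

definition fact_quot :: "nat \<Rightarrow> nat list \<Rightarrow> rat" where
  "fact_quot s I = prod_list (map (\<lambda>x. fact x / fact (x + s)) I)"

text \<open>The constant C gathers the factors that clear denominators and the positions not covered
  by \<open>cs\<close>. It is the same for all l, so by positivity it does not affect the sign of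
  the sum.\<close>

lemma content_weight_eq:
  assumes "length cs \<le> n"
  shows "\<exists>C>0. \<forall>l. length l \<le> length cs \<longrightarrow> (\<forall>i<length l. l ! i \<le> cs ! i) \<longrightarrow>
           rat_of_int (content_weight (int n - 1) (int n - 1 + int s) cs l) = C * fact_quot s (stair (pad n l))"
  using assms
proof (induction cs arbitrary: n)
  case Nil
  have pos: "fact_quot s I > 0" for I
    unfolding fact_quot_def by (induction I) auto
  show ?case
    using pos[of "stair (pad n [])"]
    by (intro exI[of _ "1 / fact_quot s (stair (pad n []))"]) auto
next
  case (Cons c cs)
  then obtain p where n: "n = Suc p" "length cs \<le> p"
    by (cases n) auto
  obtain C where "C > 0" and C: "\<And>l. length l \<le> length cs \<Longrightarrow> (\<forall>i<length l. l ! i \<le> cs ! i) \<Longrightarrow>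
      rat_of_int (content_weight (int p - 1) (int p - 1 + int s) cs l) = C * fact_quot s (stair (pad p l))"
    using Cons.IH[OF n(2)] by auto
  define C' where "C' = C * (fact (p + s + c) / fact p)"
  have quot: "fact_quot s (stair (e @ [x])) = fact_quot s (stair e) * (fact (length e + x) / fact (length e + x + s))" for e x
    by (simp add: fact_quot_def stair_from_append)
  have "rat_of_int (content_weight (int n - 1) (int n - 1 + int s) (c # cs) l) = C' * fact_quot s (stair (pad n l))"
    if l: "length l \<le> length (c # cs)" "\<forall>i<length l. l ! i \<le> (c # cs) ! i" for l
  proof -
    define x where "x = (case l of [] \<Rightarrow> 0 | x # _ \<Rightarrow> x)"
    have "x \<le> c"
      using l(2) by (auto simp: x_def split: list.splits)
    have "tl l ! i \<le> cs ! i" if "i < length (tl l)" for i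
      using l(2)[rule_format, of "Suc i"] that by (simp add: nth_tl)
    then have tl: "length (tl l) \<le> length cs" "\<forall>i<length (tl l). tl l ! i \<le> cs ! i"
      using l(1) by auto
    have "content_weight (int n - 1) (int n - 1 + int s) (c # cs) l =
        content_row (int p) (int (p + s)) c ! x * content_weight (int p - 1) (int p - 1 + int s) cs (tl l)"
      by (cases l) (simp_all add: n x_def algebra_simps)
    moreover have "pad n l = pad p (tl l) @ [x]"
      using l n by (cases l) (auto simp: pad_Cons pad_Nil x_def)
    moreover have "length (pad p (tl l)) = p"
      using tl(1) n(2) by simp
    ultimately show ?thesis
      using C[OF tl] nth_content_row[OF \<open>x \<le> c\<close>, of p s]
      by (simp add: quot C'_def add_ac)
  qed
  moreover have "C' > 0"
    using \<open>C > 0\<close> by (simp add: C'_def)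
  ultimately show ?case by blast
qed

text \<open>All dependence on s moves into a product over the entries. The remaining factor is also
  independent of n by \<open>schur_weight_0_pad\<close>, so it is tabulated once for each N.\<close>

lemma schur_weight_fact_quot: "schur_weight s I = schur_weight 0 I * fact_quot s I"
  by (simp add: schur_weight_def fact_quot_def prod.list_conv_set_nth prod_dividef atLeast0LessThan)

lemma vdm_Suc: "vdm (Suc n) x = (\<Prod>i<n. x (Suc i) - x 0) * vdm n (\<lambda>i. x (Suc i))"
proof -
  have "vdm (Suc n) x = (\<Prod>l<n. \<Prod>j<Suc l. x (Suc l) - x j)"
    by (simp add: vdm_def prod.lessThan_Suc_shift del: prod.lessThan_Suc)
  also have "\<dots> = (\<Prod>l<n. (x (Suc l) - x 0) * (\<Prod>j<l. x (Suc l) - x (Suc j)))"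
    by (simp add: prod.lessThan_Suc_shift del: prod.lessThan_Suc)
  finally show ?thesis
    by (simp add: vdm_def prod.distrib)
qed

lemma schur_weight_0_Cons: "schur_weight 0 (0 # map Suc I) = schur_weight 0 I"
proof -
  have "(\<Prod>a<length I. fact (Suc (I ! a)) :: rat) = (\<Prod>a<length I. of_nat (Suc (I ! a))) * (\<Prod>a<length I. fact (I ! a))"
    by (simp add: prod.distrib)
  moreover have "vdm (length I) (\<lambda>i. of_nat (map Suc I ! i) :: rat) = vdm (length I) (\<lambda>i. of_nat (I ! i))"
    by (simp add: vdm_def)
  moreover have "(\<Prod>a<length I. rat_of_nat (Suc (I ! a))) \<noteq> 0"
    by (simp del: of_nat_Suc)
  ultimately show ?thesis
    by (simp add: schur_weight_def vdm_Suc prod.lessThan_Suc_shift del: prod.lessThan_Suc of_nat_Suc fact_Suc)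
qed

text \<open>For s = 0 and a partition l the value is the reciprocal of the hook product of l, which
  ignores empty rows. Here it follows by cancelling the differences to the new entry 0 against the
  growth of the factorials.\<close>

lemma schur_weight_0_pad:
  "length l \<le> n \<Longrightarrow> schur_weight 0 (stair (pad n l)) = schur_weight 0 (stair (rev l))"
proof (induction n)
  case (Suc n)
  show ?case
  proof (cases "length l \<le> n")
    case True
    then show ?thesis
      using Suc schur_weight_0_Cons[of "stair (pad n l)"] by (simp add: pad_Suc stair_from_Suc[of 0, symmetric, simplified])
  next
    case False
    then show ?thesis
      using Suc.prems by (simp add: pad_def)
  qed
qed (simp add: pad_def)

text \<open>Multiplying by N! and by the constant of \<open>content_weight_eq\<close> makes all
  terms integers without changing the sign. The bound N <= r + 1 gives every partition of size at
  most N enough rows.\<close>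

lemma smrc_coeff_eq_trie_sum:
  fixes w c :: "nat list \<Rightarrow> int"
  assumes codim: "smrc_codim g r d = int N" and "N \<le> r + 1"
    and w: "\<And>l. l \<in> partitions_upto N N \<Longrightarrow> rat_of_int (w l) =
      fact N * ((- 4) ^ (N - sum_list l) / fact (N - sum_list l)) * schur_weight 0 (stair (rev l))"
    and c: "\<And>l. l \<in> partitions_upto N N \<Longrightarrow> rat_of_int (c l) = sdet_part (r + 1) l"
  shows "0 < smrc_coeff g r d \<longleftrightarrow>
    0 < trie_sum (content_rows (int r) (int r + int (r + g - d)) (map (\<lambda>i. N div Suc i) [0..<N]))
          (map_trie (\<lambda>l. w l * c l) (partition_trie N [] N N))"
proof -
  define n where "n = r + 1"
  define s where "s = r + g - d"
  define cs where "cs = map (\<lambda>i. N div Suc i) [0..<N]"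
  define P where "P = partitions_upto N N"
  have "length cs = N"
    by (simp add: cs_def)
  then obtain C where "C > 0" and C: "\<And>l. length l \<le> N \<Longrightarrow> (\<forall>i<length l. l ! i \<le> cs ! i) \<Longrightarrow>
      rat_of_int (content_weight (int n - 1) (int n - 1 + int s) cs l) = C * fact_quot s (stair (pad n l))"
    using content_weight_eq[of cs n s] assms(2) by (auto simp: n_def)
  have weight: "rat_of_int (w l * c l * content_weight (int r) (int r + int s) cs l) =
      fact N * C * ((- 4) ^ (N - sum_list l) / fact (N - sum_list l) *
        (sdet_part n l * schur_weight s (stair (pad n l))))" if l: "l \<in> P" for l
  proof -
    have "length l \<le> N"
      using l length_partition_le by (simp add: P_def)
    moreover have "l ! i \<le> cs ! i" if "i < length l" for i
      using nth_partition_le[OF l[unfolded P_def] that] that calculation by (simp add: cs_def)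
    ultimately have "rat_of_int (content_weight (int r) (int r + int s) cs l) = C * fact_quot s (stair (pad n l))"
      using C[of l] by (simp add: n_def)
    moreover have "schur_weight s (stair (pad n l)) = schur_weight 0 (stair (rev l)) * fact_quot s (stair (pad n l))"
      using schur_weight_fact_quot[of s "stair (pad n l)"] schur_weight_0_pad[of l n] \<open>length l \<le> N\<close> assms(2)
      by (simp add: n_def)
    ultimately show ?thesis
      using w[OF l[unfolded P_def]] c[OF l[unfolded P_def]] by (simp add: n_def)
  qed
  have "smrc_coeff g r d = (\<Sum>k\<le>N. \<Sum>l\<in>{l \<in> P. sum_list l = k}.
      (- 4) ^ (N - k) / fact (N - k) * (sdet_part n l * schur_weight s (stair (pad n l))))"
    unfolding smrc_coeff_eq[OF codim]
    by (intro sum.cong refl) (simp add: n_def s_def P_def sdet_sum_eq_partitions[where N = N] sum_distrib_left)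
  also have "\<dots> = (\<Sum>k\<le>N. \<Sum>l\<in>{l \<in> P. sum_list l = k}.
      (- 4) ^ (N - sum_list l) / fact (N - sum_list l) * (sdet_part n l * schur_weight s (stair (pad n l))))"
    by (intro sum.cong refl) simp
  also have "\<dots> = (\<Sum>l\<in>P.
      (- 4) ^ (N - sum_list l) / fact (N - sum_list l) * (sdet_part n l * schur_weight s (stair (pad n l))))"
    by (rule sum.group) (simp_all add: P_def finite_partitions_upto, auto simp: partitions_upto_def)
  finally have "fact N * C * smrc_coeff g r d = (\<Sum>l\<in>P. fact N * C * ((- 4) ^ (N - sum_list l) / fact (N - sum_list l) *
        (sdet_part n l * schur_weight s (stair (pad n l)))))"
    by (simp only: sum_distrib_left)
  also have "\<dots> = (\<Sum>l\<in>P. rat_of_int (w l * c l * content_weight (int r) (int r + int s) cs l))"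
    by (intro sum.cong refl) (simp only: weight)
  also have "\<dots> = rat_of_int (trie_sum (content_rows (int r) (int r + int s) cs)
      (map_trie (\<lambda>l. w l * c l) (partition_trie N [] N N)))"
    by (subst trie_sum_partition_trie) (auto simp: cs_def P_def)
  finally have "0 < rat_of_int (trie_sum (content_rows (int r) (int r + int s) cs)
      (map_trie (\<lambda>l. w l * c l) (partition_trie N [] N N))) \<longleftrightarrow> 0 < fact N * C * smrc_coeff g r d"
    by simp
  also have "\<dots> \<longleftrightarrow> 0 < smrc_coeff g r d"
  proof -
    have "0 < fact N * C"
      using \<open>C > 0\<close> by simp
    then show ?thesis
      by (metis mult_pos_pos zero_less_mult_pos)
  qed
  finally show ?thesis
    by (simp add: cs_def s_def)
qed

section \<open>The executable check over a finite range of r\<close>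

fun strip_count :: "nat \<Rightarrow> nat list \<Rightarrow> int" where
  "strip_count 0 l = (if l = [] then 1 else 0)"
| "strip_count (Suc n) l =
    (if length l \<le> n then sum_list (map (strip_count n) (strips l))
     else if length l = Suc n \<and> last l = 1 then 2 * sum_list (map (strip_count n) (strips (butlast l)))
     else 0)"

lemma of_int_strip_count:
  "sorted_wrt (\<ge>) l \<Longrightarrow> 0 \<notin> set l \<Longrightarrow> rat_of_int (strip_count n l) = sdet_part n l"
proof (induction n arbitrary: l)
  case (Suc n)
  have sum_list_of_int: "rat_of_int (sum_list xs) = sum_list (map rat_of_int xs)" for xs
    by (induction xs) auto
  have IH: "rat_of_int (sum_list (map (strip_count n) (strips m))) = sum_list (map (sdet_part n) (strips m))" for m
  proof -
    have "map (\<lambda>x. rat_of_int (strip_count n x)) (strips m) = map (sdet_part n) (strips m)"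
      using strips_props[of _ m] by (intro map_cong refl Suc.IH) auto
    then show ?thesis
      by (simp only: sum_list_of_int map_map o_def)
  qed
  show ?case
    using sdet_part_Suc[OF Suc.prems, of n] by (simp add: IH)
qed (simp add: sdet_part_0)

lemma sum_list_strips: "m \<in> set (strips l) \<Longrightarrow> sum_list m \<le> sum_list l"
proof (induction l arbitrary: m)
  case (Cons x l)
  then obtain m' y where m': "m' \<in> set (strips l)" "m \<in> set (extend y m')" "y \<le> x"
    by (auto simp: set_extend_strip)
  have "sum_list m = y + sum_list m'"
    using m'(2) by (cases m') (auto split: if_splits)
  with Cons.IH[OF m'(1)] m'(3) show ?case by simp
qed simp

text \<open>Guarantees that every lookup in the branching recursion hits a key stored in the trie
  for N.\<close>

lemma strips_partitions_upto:
  assumes "m \<in> set (strips l)" "sum_list l \<le> N"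
  shows "m \<in> partitions_upto N N"
proof -
  have "sum_list m \<le> N"
    using sum_list_strips[OF assms(1)] assms(2) by simp
  with strips_props[OF assms(1)] show ?thesis
    by (auto simp: partitions_upto_def intro!: Nat.gr0I intro: order_trans[OF member_le_sum_list])
qed

fun fact_int :: "nat \<Rightarrow> int" where
  "fact_int 0 = 1"
| "fact_int (Suc n) = int (Suc n) * fact_int n"

fun diff_prod :: "nat \<Rightarrow> nat list \<Rightarrow> int" where
  "diff_prod x [] = 1"
| "diff_prod x (y # ys) = (int y - int x) * diff_prod x ys"

fun vdm_list :: "nat list \<Rightarrow> int" where
  "vdm_list [] = 1"
| "vdm_list (x # xs) = diff_prod x xs * vdm_list xs"

fun fact_list :: "nat list \<Rightarrow> int" where
  "fact_list [] = 1"
| "fact_list (x # xs) = fact_int x * fact_list xs"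

lemma of_int_fact_int: "rat_of_int (fact_int n) = fact n"
  by (induction n) auto

lemma schur_weight_0_eq: "schur_weight 0 I = rat_of_int (vdm_list I) / rat_of_int (fact_list I)"
proof -
  have "rat_of_int (diff_prod x xs) = (\<Prod>i<length xs. of_nat (xs ! i) - of_nat x)" for x xs
    by (induction x xs rule: diff_prod.induct) (simp_all add: prod.lessThan_Suc_shift del: prod.lessThan_Suc)
  then have "rat_of_int (vdm_list I) = vdm (length I) (\<lambda>a. of_nat (I ! a))"
    by (induction I rule: vdm_list.induct) (simp_all add: vdm_Suc, simp add: vdm_def)
  moreover have "rat_of_int (fact_list I) = (\<Prod>a<length I. fact (I ! a))"
    by (induction I rule: fact_list.induct)
       (simp_all add: of_int_fact_int prod.lessThan_Suc_shift del: prod.lessThan_Suc)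
  ultimately show ?thesis
    by (simp add: schur_weight_def)
qed

text \<open>For a partition l of k this is (-4)^(N-k) (N choose k) f, where f is the number of
  standard Young tableaux of shape l; hence it is an integer.\<close>

definition partition_weight :: "nat \<Rightarrow> nat list \<Rightarrow> int" where
  "partition_weight N l = (- 4) ^ (N - sum_list l) * (fact_int N div fact_int (N - sum_list l)) *
     vdm_list (stair (rev l)) div fact_list (stair (rev l))"

type_synonym info = "nat list \<times> int \<times> int \<times> nat list list"

text \<open>Everything that does not depend on n, computed once per N; only the counts are updated
  as n grows.\<close>

definition partition_info :: "nat \<Rightarrow> nat list \<Rightarrow> info" where
  "partition_info N l = (l, int (length l), partition_weight N l, strips l)"

text \<open>The integer divisions in \<open>partition_weight\<close> are exact; this is part of the computation.\<close>

fun exact_weight :: "nat \<Rightarrow> info \<Rightarrow> bool" where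
  "exact_weight N (l, len, w, st) \<longleftrightarrow> w * fact_int (N - sum_list l) * fact_list (stair (rev l)) =
     (- 4) ^ (N - sum_list l) * fact_int N * vdm_list (stair (rev l))"

fun all_trie :: "('a \<Rightarrow> bool) \<Rightarrow> 'a trie \<Rightarrow> bool" where
  "all_trie P (Node v ts) \<longleftrightarrow> P v \<and> list_all (all_trie P) ts"

lemma all_trie_iff: "all_trie P t \<longleftrightarrow> (\<forall>x\<in>set_trie t. P x)"
  by (induction t) (auto simp: list_all_iff)

fun lookup_sum :: "int trie \<Rightarrow> nat list list \<Rightarrow> int" where
  "lookup_sum t [] = 0"
| "lookup_sum t (l # ls) = lookup t l + lookup_sum t ls"

fun next_count :: "int \<Rightarrow> int trie \<Rightarrow> info \<Rightarrow> int" where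
  "next_count n t (l, len, w, st) =
    (if len \<le> n then lookup_sum t st
     else if len = n + 1 \<and> last l = 1 then 2 * lookup_sum t (strips (butlast l))
     else 0)"

fun weigh :: "int trie \<Rightarrow> info \<Rightarrow> int" where
  "weigh t (l, len, w, st) = w * lookup t l"

fun first_count :: "info \<Rightarrow> int" where
  "first_count (l, len, w, st) = (if len = 0 then 1 else 0)"

text \<open>Here n = r + 1. The first test skips pairs with rho < N. The second is an equality of
  truth values, so a pair listed in \<open>ex\<close> must indeed fail to be positive.\<close>

fun check_row :: "int \<Rightarrow> nat list \<Rightarrow> (int \<times> int) list \<Rightarrow> int \<Rightarrow> int trie \<Rightarrow> int list \<Rightarrow> bool" where
  "check_row N cs ex n t [] = True"
| "check_row N cs ex n t (s # ss) =
    (if (n - 2) * (n - 1 - 2 * s) < 4 * N - 2 then check_row N cs ex n t ss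
     else if (0 < trie_sum (content_rows (n - 1) (n - 1 + s) cs) t) = ((n, s) \<notin> set ex) then check_row N cs ex n t ss
     else False)"

text \<open>The counts are advanced from n = 0, but signs are tested only for n >= N, where
  \<open>smrc_coeff_eq_trie_sum\<close> applies. The range of s is 2s <= r.\<close>

fun check_rows :: "int \<Rightarrow> nat list \<Rightarrow> (int \<times> int) list \<Rightarrow> info trie \<Rightarrow> nat \<Rightarrow> int \<Rightarrow> int trie \<Rightarrow> bool" where
  "check_rows N cs ex K 0 n t = True"
| "check_rows N cs ex K (Suc m) n t =
    (if if n < N then True else check_row N cs ex n (map_trie (weigh t) K) [0..(n - 1) div 2]
     then check_rows N cs ex K m (n + 1) (map_trie (next_count n t) K)
     else False)"

fun check_info :: "nat \<Rightarrow> nat list \<Rightarrow> (int \<times> int) list \<Rightarrow> nat \<Rightarrow> info trie \<Rightarrow> bool" where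
  "check_info N cs ex m K =
    (if all_trie (exact_weight N) K then check_rows (int N) cs ex K m 0 (map_trie first_count K) else False)"

definition check :: "nat \<Rightarrow> nat list \<Rightarrow> (int \<times> int) list \<Rightarrow> nat \<Rightarrow> bool" where
  "check N cs ex m = check_info N cs ex m (map_trie (partition_info N) (partition_trie N [] N N))"

lemma check_row_sound:
  "check_row N cs ex n t ss \<Longrightarrow> s \<in> set ss \<Longrightarrow> (n - 2) * (n - 1 - 2 * s) \<ge> 4 * N - 2 \<Longrightarrow>
   0 < trie_sum (content_rows (n - 1) (n - 1 + s) cs) t \<longleftrightarrow> (n, s) \<notin> set ex"
  by (induction N cs ex n t ss rule: check_row.induct) (auto split: if_splits)

lemma lookup_sum_eq: "lookup_sum t ls = sum_list (map (lookup t) ls)"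
  by (induction ls) auto

text \<open>The invariant is that the last argument holds \<open>strip_count n\<close> on all
  partitions of size at most N; \<open>next_count\<close> reproduces the recursion from stored
  values.\<close>

lemma check_rows_sound:
  assumes "check_rows (int N) cs ex (map_trie (partition_info N) K) m (int n) (map_trie (strip_count n) K)"
    and K: "K = partition_trie N [] N N"
    and "n \<le> n'" "n' < n + m" "N \<le> n'" "0 \<le> s" "s \<le> (int n' - 1) div 2"
    and "(int n' - 2) * (int n' - 1 - 2 * s) \<ge> 4 * int N - 2"
  shows "0 < trie_sum (content_rows (int n' - 1) (int n' - 1 + s) cs)
      (map_trie (\<lambda>l. partition_weight N l * strip_count n' l) K) \<longleftrightarrow> (int n', s) \<notin> set ex"
  using assms
proof (induction m arbitrary: n)
  case (Suc m)
  let ?I = "map_trie (partition_info N) K"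
  have set_K: "set_trie K = partitions_upto N N"
    using set_partition_trie[of N N "[]" N] by (simp add: K)
  have lookup: "lookup (map_trie f K) l = f l" if "l \<in> partitions_upto N N" for f :: "nat list \<Rightarrow> int" and l
    using lookup_partition_trie[OF that, of N f "[]"] by (simp add: K)
  have weigh: "map_trie (weigh (map_trie (strip_count n) K)) ?I = map_trie (\<lambda>l. partition_weight N l * strip_count n l) K"
    unfolding trie.map_comp
    by (rule trie.map_cong) (use set_K in \<open>auto simp: partition_info_def lookup\<close>)
  have lookup_sum: "lookup_sum (map_trie (strip_count n) K) (strips l) = sum_list (map (strip_count n) (strips l))"
    if "sum_list l \<le> N" for l
    unfolding lookup_sum_eq using strips_partitions_upto[OF _ that] by (intro arg_cong[where f = sum_list] map_cong refl lookup)
  have "next_count (int n) (map_trie (strip_count n) K) (partition_info N l) = strip_count (Suc n) l" if "l \<in> set_trie K" for l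
  proof -
    have "sum_list l \<le> N"
      using that set_K by (auto simp: partitions_upto_def)
    moreover from this have "sum_list (butlast l) \<le> N"
      by (cases l rule: rev_cases) auto
    ultimately show ?thesis
      by (auto simp: partition_info_def lookup_sum)
  qed
  then have "map_trie (next_count (int n) (map_trie (strip_count n) K)) ?I = map_trie (strip_count (Suc n)) K"
    unfolding trie.map_comp by (intro trie.map_cong) auto
  with Suc.prems(1) have row: "n < N \<or> check_row (int N) cs ex (int n)
        (map_trie (\<lambda>l. partition_weight N l * strip_count n l) K) [0..(int n - 1) div 2]"
    and rest: "check_rows (int N) cs ex ?I m (int (Suc n)) (map_trie (strip_count (Suc n)) K)"
    by (auto simp: weigh add.commute split: if_splits simp del: strip_count.simps)
  show ?case
  proof (cases "n' = n")
    case True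
    show ?thesis
      unfolding True by (rule check_row_sound) (use row Suc.prems True in auto)
  next
    case False
    show ?thesis
      by (rule Suc.IH[OF rest K]) (use False Suc.prems in auto)
  qed
qed simp

lemma smrc_coeff_pos_iff_if_check:
  assumes "check N (map (\<lambda>i. N div Suc i) [0..<N]) ex m"
    and "smrc_codim g r d = int N" "N \<le> r + 1" "r + 1 < m" "2 * (r + g - d) \<le> r"
    and "(int r - 1) * (int r - 2 * int (r + g - d)) \<ge> 4 * int N - 2"
  shows "0 < smrc_coeff g r d \<longleftrightarrow> (int r + 1, int (r + g - d)) \<notin> set ex"
proof -
  define K where "K = partition_trie N [] N N"
  have set_K: "set_trie K = partitions_upto N N"
    using set_partition_trie[of N N "[]" N] by (simp add: K_def)
  define cs where "cs = map (\<lambda>i. N div Suc i) [0..<N]"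
  have "first_count (partition_info N l) = strip_count 0 l" for l
    by (auto simp: partition_info_def)
  then have "map_trie first_count (map_trie (partition_info N) K) = map_trie (strip_count 0) K"
    unfolding trie.map_comp by (intro trie.map_cong) auto
  with assms(1) have exact: "all_trie (exact_weight N) (map_trie (partition_info N) K)"
    and rows: "check_rows (int N) cs ex (map_trie (partition_info N) K) m (int 0) (map_trie (strip_count 0) K)"
    by (auto simp: check_def cs_def K_def split: if_splits simp del: strip_count.simps)
  have "0 < smrc_coeff g r d \<longleftrightarrow> 0 < trie_sum (content_rows (int r) (int r + int (r + g - d)) cs)
      (map_trie (\<lambda>l. partition_weight N l * strip_count (r + 1) l) K)"
    unfolding cs_def K_def
  proof (rule smrc_coeff_eq_trie_sum)
    fix l assume l: "l \<in> partitions_upto N N"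
    have "l \<in> set_trie K"
      using l by (simp add: set_K)
    then have "exact_weight N (partition_info N l)"
      using exact by (simp add: all_trie_iff trie.set_map)
    then have "rat_of_int (partition_weight N l * fact_int (N - sum_list l) * fact_list (stair (rev l))) =
        rat_of_int ((- 4) ^ (N - sum_list l) * fact_int N * vdm_list (stair (rev l)))"
      unfolding partition_info_def exact_weight.simps by (rule arg_cong)
    then have "rat_of_int (partition_weight N l) * fact (N - sum_list l) * rat_of_int (fact_list (stair (rev l))) =
        (- 4) ^ (N - sum_list l) * fact N * rat_of_int (vdm_list (stair (rev l)))"
      by (simp add: of_int_fact_int)
    moreover have "fact_list I > 0" for I
    proof -
      have "fact_int x > 0" for x
        by (induction x) auto
      then show ?thesis
        by (induction I) auto
    qed
    then have "rat_of_int (fact_list (stair (rev l))) \<noteq> 0"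
      by (metis less_irrefl of_int_eq_0_iff)
    ultimately show "rat_of_int (partition_weight N l) =
        fact N * ((- 4) ^ (N - sum_list l) / fact (N - sum_list l)) * schur_weight 0 (stair (rev l))"
      by (simp add: schur_weight_0_eq field_simps)
    show "rat_of_int (strip_count (r + 1) l) = sdet_part (r + 1) l"
      using l by (intro of_int_strip_count) (auto simp: partitions_upto_def)
  qed (use assms in auto)
  also have "\<dots> \<longleftrightarrow> (int r + 1, int (r + g - d)) \<notin> set ex"
    using check_rows_sound[OF rows K_def, of "r + 1" "int (r + g - d)"] assms
    by (simp add: algebra_simps)
  finally show ?thesis .
qed

section \<open>The finitely many remaining cases\<close>

text \<open>In these checks, the pairs are (r + 1, s) for the exceptional cases, and the last
  argument is k + 1 for the least k such that \<open>smrc_coeff_pos_if_quadratic\<close> covers all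
  r >= k. The list is the sequence of row bounds \<open>N div Suc i\<close>.\<close>

lemma check_1: "check 1 [1] [(3, 0), (4, 1)] 5"
  by code_simp

lemma check_2: "check 2 [2, 1] [(4, 0), (5, 1)] 12"
  by code_simp

lemma check_3: "check 3 [3, 1, 1] [] 18"
  by code_simp

lemma check_4: "check 4 [4, 2, 1, 1] [] 25"
  by code_simp

lemma check_5: "check 5 [5, 2, 1, 1, 1] [] 32"
  by code_simp

lemma check_6: "check 6 [6, 3, 2, 1, 1, 1] [] 38"
  by code_simp

lemma check_7: "check 7 [7, 3, 2, 1, 1, 1, 1] [] 45"
  by code_simp

lemma upt_numeral: "[0..<numeral v] = [0..<pred_numeral v] @ [pred_numeral v]"
  by (simp add: numeral_eq_Suc)

text \<open>Eliminates s from the large-r criterion through 2s <= r - 1.\<close>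

lemma smrc_coeff_pos_if_quadratic:
  assumes "smrc_codim g r d = int N" "2 * (r + g - d) < r"
    and quad: "int (2 * N) * (3 * int r + 2 * int N - 1) < int r * int r + 3 * int r + 4 - 2 * int N"
  shows "smrc_coeff g r d > 0"
proof (rule smrc_coeff_pos_if_large[OF assms(1)])
  have "4 * N * (r + N + (r + g - d)) = 2 * N * (2 * r + 2 * N + 2 * (r + g - d))"
    by simp
  also have "int \<dots> \<le> int (2 * N) * (3 * int r + 2 * int N - 1)"
    unfolding of_nat_mult using assms(2) by (intro mult_left_mono) (auto simp: algebra_simps)
  also note quad
  finally have "int (4 * N * (r + N + (r + g - d))) < int ((r + 1) * (r + 2)) + 2 - 2 * int N"
    by (simp add: algebra_simps)
  then show "4 * N * (r + N + (r + g - d)) < (r + 1) * (r + 2) + 2 - 2 * N"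
    by linarith
qed

lemma smrc_coeff_pos_iff_small_codim:
  assumes codim: "smrc_codim g r d = int N" and N: "1 \<le> N" "N \<le> 7"
    and s: "2 * (r + g - d) < r"
    and dim: "(int r - 1) * (int r - 2 * int (r + g - d)) \<ge> 4 * int N - 2"
  shows "0 < smrc_coeff g r d \<longleftrightarrow>
    \<not> (N = 1 \<and> (r, r + g - d) \<in> {(2, 0), (3, 1)} \<or> N = 2 \<and> (r, r + g - d) \<in> {(3, 0), (4, 1)})"
proof -
  \<comment> \<open>If r <= N - 2, the dimension condition would give 4N - 2 <= (N-3)(N-2), that is,
    (N-1)(N-8) >= 0. This is impossible for 2 <= N <= 7.\<close>
  have "N \<le> r + 1"
  proof (rule ccontr)
    assume "\<not> N \<le> r + 1"
    then have le: "int r \<le> int N - 2" by simp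
    have "(int r - 1) * (int r - 2 * int (r + g - d)) \<le> (int r - 1) * int r"
      using s by (intro mult_left_mono) auto
    also have "\<dots> \<le> (int N - 3) * (int N - 2)"
      using le s by (intro mult_mono) auto
    finally have "4 * int N - 2 \<le> (int N - 3) * (int N - 2)"
      using dim by linarith
    then have "0 \<le> (int N - 1) * (int N - 8)"
      by (simp add: algebra_simps)
    moreover have "(int N - 1) * (int N - 8) < 0"
      using N le by (intro mult_pos_neg) auto
    ultimately show False by linarith
  qed
  have checked: "0 < smrc_coeff g r d \<longleftrightarrow> (int r + 1, int (r + g - d)) \<notin> set ex"
    if "check N cs ex m" "cs = map (\<lambda>i. N div Suc i) [0..<N]" "r + 1 < m" for cs ex m
    using smrc_coeff_pos_iff_if_check[OF that(1)[unfolded that(2)] codim \<open>N \<le> r + 1\<close> that(3)] s dim by simp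
  \<comment> \<open>Replacing r^2 by k r makes the criterion linear in r once N and k are
    numerals.\<close>
  have large: "0 < smrc_coeff g r d"
    if "k \<le> r" "int (2 * N) * (3 * int r + 2 * int N - 1) < int k * int r + 3 * int r + 4 - 2 * int N" for k
  proof (rule smrc_coeff_pos_if_quadratic[OF codim s])
    have "int k * int r \<le> int r * int r"
      using that(1) by (intro mult_right_mono) auto
    with that(2) show "int (2 * N) * (3 * int r + 2 * int N - 1) < int r * int r + 3 * int r + 4 - 2 * int N"
      by linarith
  qed
  consider "N = 1" | "N = 2" | "N = 3" | "N = 4" | "N = 5" | "N = 6" | "N = 7"
    using N by linarith
  then show ?thesis
  proof cases
    case 1
    then show ?thesis
      using checked[OF check_1[folded 1]] large[of 4] by (cases "r < 4") auto
  next
    case 2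
    then show ?thesis
      using checked[OF check_2[folded 2]] large[of 11] by (cases "r < 11") (auto simp: upt_numeral simp flip: numeral_2_eq_2)
  next
    case 3
    then show ?thesis
      using checked[OF check_3[folded 3]] large[of 17] by (cases "r < 17") (auto simp: upt_numeral simp flip: numeral_2_eq_2)
  next
    case 4
    then show ?thesis
      using checked[OF check_4[folded 4]] large[of 24] by (cases "r < 24") (auto simp: upt_numeral simp flip: numeral_2_eq_2)
  next
    case 5
    then show ?thesis
      using checked[OF check_5[folded 5]] large[of 31] by (cases "r < 31") (auto simp: upt_numeral simp flip: numeral_2_eq_2)
  next
    case 6
    then show ?thesis
      using checked[OF check_6[folded 6]] large[of 37] by (cases "r < 37") (auto simp: upt_numeral simp flip: numeral_2_eq_2)
  next
    case 7
    then show ?thesis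
      using checked[OF check_7[folded 7]] large[of 44] by (cases "r < 44") (auto simp: upt_numeral simp flip: numeral_2_eq_2)
  qed
qed

theorem theorem1p1:
  fixes g r d :: nat
  assumes "g \<ge> 1" and "r \<ge> 1" and "d \<ge> 1"
    and "d \<ge> g" and "int r + int g - int d \<ge> 0"
    and "smrc_codim g r d \<ge> 1"
    and "rho g r d - smrc_codim g r d \<ge> 0"
  shows "(smrc_codim g r d \<le> 2 \<longrightarrow>
            (smrc_strictly_positive g r d \<longleftrightarrow>
              \<not> (smrc_codim g r d = 1 \<and> (g, r, d) \<in> {(1, 2, 3), (5, 3, 7)} \<or>
                 smrc_codim g r d = 2 \<and> (g, r, d) \<in> {(2, 3, 5), (7, 4, 10)})))
       \<and> (3 \<le> smrc_codim g r d \<and> smrc_codim g r d \<le> 7 \<longrightarrow> smrc_strictly_positive g r d)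
       \<and> (int r \<ge> 12 * smrc_codim g r d - 2 \<longrightarrow> smrc_strictly_positive g r d)"
proof -
  define N where "N = nat (smrc_codim g r d)"
  define s where "s = r + g - d"
  have codim: "smrc_codim g r d = int N"
    using assms(6) by (simp add: N_def)
  have "N \<ge> 1"
    using assms(6) by (simp add: N_def)
  have s: "int s = int r + int g - int d"
    using assms(5) by (simp add: s_def)
  have positive_iff: "smrc_strictly_positive g r d \<longleftrightarrow> 0 < smrc_coeff g r d"
    by (rule smrc_strictly_positive_iff) (use assms in auto)
  have "2 * ((r + 2) choose 2) = (r + 2) * (r + 1)"
    by (simp add: choose_two)
  from arg_cong[OF this, of int] have choose: "2 * int ((r + 2) choose 2) = (int r + 2) * (int r + 1)"
    by (simp only: of_nat_mult of_nat_add of_nat_numeral of_nat_1)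
  then have g: "2 * int g = (int r + 2) * (int r + 1) - 4 * int r + 4 * int s - 2 * int N"
    using codim s by (simp add: smrc_codim_def)
  \<comment> \<open>Twice the inequality rho >= N, with g eliminated through the formula for
    N.\<close>
  have dim: "(int r - 1) * (int r - 2 * int s) \<ge> 4 * int N - 2"
    using assms(7) g unfolding rho_def codim s[symmetric] by (simp add: algebra_simps)
  have "(int r - 1) * (int r - 2 * int s) > 0"
    using dim \<open>N \<ge> 1\<close> by linarith
  then have s_less: "2 * s < r"
    using assms(2) by (simp add: zero_less_mult_iff)
  \<comment> \<open>For fixed N and r, the formula for 2g shows that s determines g, and then d = r
    + g - s; so the computed pairs (r, s) correspond to the triples.\<close>
  have exceptions: "(N = 1 \<and> (r, s) \<in> {(2, 0), (3, 1)} \<or> N = 2 \<and> (r, s) \<in> {(3, 0), (4, 1)}) \<longleftrightarrow>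
      (N = 1 \<and> (g, r, d) \<in> {(1, 2, 3), (5, 3, 7)} \<or> N = 2 \<and> (g, r, d) \<in> {(2, 3, 5), (7, 4, 10)})"
  proof -
    have "s = 0 \<longleftrightarrow> g = 1 \<and> d = 3" if "N = 1" "r = 2"
      using g s unfolding that by simp presburger
    moreover have "s = 1 \<longleftrightarrow> g = 5 \<and> d = 7" if "N = 1" "r = 3"
      using g s unfolding that by simp presburger
    moreover have "s = 0 \<longleftrightarrow> g = 2 \<and> d = 5" if "N = 2" "r = 3"
      using g s unfolding that by simp presburger
    moreover have "s = 1 \<longleftrightarrow> g = 7 \<and> d = 10" if "N = 2" "r = 4"
      using g s unfolding that by simp presburger
    ultimately show ?thesis by auto
  qed
  have large_r: "smrc_strictly_positive g r d" if "int r \<ge> 12 * int N - 2"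
    unfolding positive_iff
  proof (rule smrc_coeff_pos_if_quadratic[OF codim s_less[unfolded s_def]])
    define q where "q = int r * int r"
    have "q \<ge> 0"
      by (simp add: q_def)
    \<comment> \<open>From 12 N <= r + 2, multiplied by r and squared, one gets 6 N r <= (r^2 +
      2r)/2 and 4 N^2 <= (r^2 + 4r + 4)/36. Their sum is below r^2 + 3r + 4, and the terms -2N on
      both sides of the criterion cancel.\<close>
    have "12 * int N * int r \<le> (int r + 2) * int r"
      using that by (intro mult_right_mono) auto
    then have "12 * (int N * int r) \<le> q + 2 * int r"
      by (simp add: q_def algebra_simps)
    moreover have "(12 * int N) * (12 * int N) \<le> (int r + 2) * (int r + 2)"
      using that by (intro mult_mono) auto
    then have "144 * (int N * int N) \<le> q + 4 * int r + 4"
      by (simp add: q_def algebra_simps)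
    ultimately have "6 * (int N * int r) + 4 * (int N * int N) < q + 3 * int r + 4"
      using \<open>q \<ge> 0\<close> by linarith
    then show "int (2 * N) * (3 * int r + 2 * int N - 1) < int r * int r + 3 * int r + 4 - 2 * int N"
      by (simp add: q_def algebra_simps)
  qed
  have small_codim: "smrc_strictly_positive g r d \<longleftrightarrow>
      \<not> (N = 1 \<and> (g, r, d) \<in> {(1, 2, 3), (5, 3, 7)} \<or> N = 2 \<and> (g, r, d) \<in> {(2, 3, 5), (7, 4, 10)})" if "N \<le> 7"
    unfolding positive_iff exceptions[symmetric]
    using smrc_coeff_pos_iff_small_codim[OF codim \<open>N \<ge> 1\<close> that s_less[unfolded s_def] dim[unfolded s_def]]
    unfolding s_def .
  have N_iff: "int N = 1 \<longleftrightarrow> N = 1" "int N = 2 \<longleftrightarrow> N = 2"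
    by auto
  show ?thesis
    unfolding codim N_iff
  proof (intro conjI impI)
    assume "int N \<le> 2"
    then show "smrc_strictly_positive g r d \<longleftrightarrow>
        \<not> (N = 1 \<and> (g, r, d) \<in> {(1, 2, 3), (5, 3, 7)} \<or> N = 2 \<and> (g, r, d) \<in> {(2, 3, 5), (7, 4, 10)})"
      by (intro small_codim) simp
  next
    assume "3 \<le> int N \<and> int N \<le> 7"
    then have "N \<le> 7" "N \<noteq> 1" "N \<noteq> 2"
      by auto
    then show "smrc_strictly_positive g r d"
      using small_codim by simp
  qed (rule large_r)
qed

end
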